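(* If $s>1/2$, then for $\mu_s$-a.e. $x\in[0,1]$ and for all four real numbers $a<b$ and $c<d$, we have $$\lim_{n\to\infty}\frac{\#\{k\in\{0,1,\dots,n-1\}:(T_k(x),V_k(x))\in(a,b)\times(c,d)\}}{n}=\hat\mu_s\big((a,b)\times(c,d)\big).$$
   Context: $G(x)=\{1/x\}=1/x-\lfloor1/x\rfloor$ for $x\in(0,1]$ ($G(0)=0$) is the Gauss map. Here $\mathbb N=\{1,2,\dots\}$ and $[\omega_1,\omega_2,\dots]=\cfrac{1}{\omega_1+\cfrac1{\omega_2+\cdots}}$ denotes a (finite or infinite) continued fraction. An irrational $x\in[0,1]$ is written uniquely $x=[\omega_1(x),\omega_2(x),\dots]$ with $\omega_i(x)\in\mathbb N$. $T_n(x)=[\omega_{n+1}(x),\omega_{n+2}(x),\dots]$ and $V_n(x)=[\omega_n(x),\dots,\omega_1(x)]$ for $n\ge1$, with $T_0(x)=x$ and $V_0(x)=0$; equivalently $(T_n(x),V_n(x))=\tilde G^n(x,0)$, where $\tilde G(x,y)=\big(G(x),\frac{1}{\omega_1(x)+y}\big)$ is the natural extension of $G$ on $[0,1]^2$. Measures. For $s>1/2$ let $\hat\phi_s:\mathbb N^{\mathbb Z}\to\mathbb R$, $\hat\phi_s(\tau)=-s\log|G'([\tau_0,\tau_1,\tau_2,\dots])|$ (where $|G'(x)|=x^{-2}$). This is a Hölder continuous summable potential, and it has a unique Gibbs (equilibrium) state $m_s$: the unique shift-invariant Borel probability on $\mathbb N^{\mathbb Z}$ for which there are $C\ge1$, $P\in\mathbb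 R$ with $C^{-1}\le m_s(\{\tau:\tau_j=\omega_j,0\le j<n\})/\exp(\sum_{j<n}\hat\phi_s(\sigma^j\omega)-Pn)\le C$ for all $n\ge1$, $\omega\in\mathbb N^{\mathbb Z}$ ($\sigma$ the left shift). $\hat\mu_s$ is the image of $m_s$ under $\tau\mapsto([\tau_0,\tau_1,\dots],[\tau_{-1},\tau_{-2},\dots])\in[0,1]^2$ (a $\tilde G$-invariant measure, the equilibrium measure of $\psi_s(x,y)=-s\log|G'(x)|$), regarded as a measure on $\mathbb R^2$, and $\mu_s=\hat\mu_s\circ p_1^{-1}$, with $p_1(x,y)=x$, is the equilibrium measure of $\phi_s=-s\log|G'|$ on $[0,1]$. *)

theory Defs
  imports "HOL-Probability.Probability"
begin

text \<open>Since \<open>1 / 0 = 0\<close>, this includes the convention that the Gauss map sends 0 to 0.\<close>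

definition gauss_map :: "real \<Rightarrow> real" where
  "gauss_map x = frac (1 / x)"

fun cf_fin :: "nat list \<Rightarrow> real" where
  "cf_fin [] = 0"
| "cf_fin (a # as) = 1 / (real a + cf_fin as)"

definition cf_inf :: "(nat \<Rightarrow> nat) \<Rightarrow> real" where
  "cf_inf w = lim (\<lambda>n. cf_fin (map w [0..<n]))"

text \<open>Digits are indexed from 0: \<open>cf_digits x i\<close> is the digit \<open>\<omega>\<close> with index \<open>i + 1\<close>.
  This and the functions \<open>cf_T\<close>, \<open>cf_V\<close> below are meaningful for irrational \<open>x\<close> in \<open>[0,1]\<close>,
  where the expansion exists and is unique.\<close>

definition cf_digits :: "real \<Rightarrow> nat \<Rightarrow> nat" where
  "cf_digits x = (THE w. (\<forall>i. w i \<ge> 1) \<and> cf_inf w = x)"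

definition cf_T :: "nat \<Rightarrow> real \<Rightarrow> real" where
  "cf_T n x = (if n = 0 then x else cf_inf (\<lambda>i. cf_digits x (n + i)))"

definition cf_V :: "nat \<Rightarrow> real \<Rightarrow> real" where
  "cf_V n x = cf_fin (rev (map (cf_digits x) [0..<n]))"

text \<open>Two-sided sequences of positive integers. The index set is countable and the alphabet
  discrete and countable, so the product sigma-algebra is the Borel sigma-algebra of the
  product topology.\<close>

definition code_space :: "(int \<Rightarrow> nat) measure" where
  "code_space = (\<Pi>\<^sub>M i\<in>UNIV. count_space {1..})"

definition left_shift :: "(int \<Rightarrow> nat) \<Rightarrow> int \<Rightarrow> nat" where
  "left_shift \<tau> = (\<lambda>i. \<tau> (i + 1))"

definition gibbs_state :: "((int \<Rightarrow> nat) \<Rightarrow> real) \<Rightarrow> (int \<Rightarrow> nat) measure \<Rightarrow> bool" where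
  "gibbs_state \<phi> m \<longleftrightarrow>
     prob_space m \<and> sets m = sets code_space \<and> distr m code_space left_shift = m \<and>
     (\<exists>C\<ge>1. \<exists>P::real. \<forall>n\<ge>1. \<forall>\<omega>\<in>space code_space.
        let r = measure m {\<tau> \<in> space code_space. \<forall>j<n. \<tau> (int j) = \<omega> (int j)} /
                exp ((\<Sum>j<n. \<phi> ((left_shift ^^ j) \<omega>)) - P * real n)
        in 1 / C \<le> r \<and> r \<le> C)"

definition gauss_potential :: "real \<Rightarrow> (int \<Rightarrow> nat) \<Rightarrow> real" where
  "gauss_potential s \<tau> = - s * ln \<bar>deriv gauss_map (cf_inf (\<lambda>i. \<tau> (int i)))\<bar>"

definition cf_code :: "(int \<Rightarrow> nat) \<Rightarrow> real \<times> real" where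
  "cf_code \<tau> = (cf_inf (\<lambda>i. \<tau> (int i)), cf_inf (\<lambda>i. \<tau> (- 1 - int i)))"

text \<open>For the Gibbs state \<open>m\<close> of \<open>gauss_potential s\<close>, the next two measures are the
  equilibrium measure of the natural extension and its first marginal, regarded as Borel
  measures on the plane and on the line.\<close>

definition mu_hat :: "(int \<Rightarrow> nat) measure \<Rightarrow> (real \<times> real) measure" where
  "mu_hat m = distr m borel cf_code"

definition mu :: "(int \<Rightarrow> nat) measure \<Rightarrow> real measure" where
  "mu m = distr (mu_hat m) borel fst"

end

theory Submission
  imports Defs
begin

text \<open>The Gibbs bounds make \<open>m\<close> quasi-Bernoulli: the measure of the cylinder of \<open>u @ v\<close> is
  comparable to the product of the measures of the cylinders of \<open>u\<close> and \<open>v\<close>. If \<open>E\<close> is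
  shift-invariant and \<open>V\<close>, which depends on finitely many coordinates, approximates \<open>E\<close>,
  then \<open>V\<close> and a far shift of its complement have small intersection, whose measure is
  nevertheless at least a constant times \<open>prob V * (1 - prob V)\<close>; hence \<open>m\<close> is ergodic.
  Birkhoff's theorem, applied to the countably many rational rectangles, gives the limit for the
  orbit of the natural extension. Two errors remain. The finite expansion \<open>cf_V k x\<close> differs from the
  second coordinate of the orbit by at most \<open>2 / 2 ^ k\<close>, and real rectangles are squeezed between
  rational ones; both are harmless because vertical and horizontal lines are null sets, the measures
  of cylinders tending to zero with their length.\<close>

section \<open>Birkhoff's ergodic theorem\<close>

text \<open>The constant \<open>K\<close> of the quasi-Bernoulli inequality does not depend on the
  lengths of the words. As the approximation of an invariant set improves, its window may widen
  without control, and the bound on \<open>prob E * (1 - prob E)\<close> still tends to zero. The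
  same uniformity makes every further digit cost a cylinder a fixed proportion of its mass.

  The obstacle at the end is that the ergodic statement concerns two-sided sequences, while the
  theorem speaks of \<open>x\<close> alone, that is, of the digits at nonnegative positions. Both
  \<open>cf_T k x\<close> and \<open>cf_V k x\<close> are computed from these digits, so the good
  sequences form the preimage of a set of numbers \<open>x\<close>. The discarded past enters the
  orbit of the natural extension only behind the first \<open>k\<close> digits of the second
  coordinate, which explains the exponentially small error. The alphabet is infinite, so cylinder
  measures are summed as integrals over counting measure, and countability of the set of words takes
  the place of finiteness.\<close>

lemma distr_integral_invariant:
  fixes h :: "'a \<Rightarrow> real"
  assumes T: "T \<in> measurable M M" "distr M M T = M" and h: "integrable M h"
  shows "integrable M (\<lambda>x. h (T x))" "(\<integral>x. h (T x) \<partial>M) = (\<integral>x. h x \<partial>M)"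
proof -
  have hm: "h \<in> borel_measurable M" using h by auto
  show "integrable M (\<lambda>x. h (T x))"
    using integrable_distr_eq[OF T(1) hm] h T(2) by simp
  show "(\<integral>x. h (T x) \<partial>M) = (\<integral>x. h x \<partial>M)"
    using integral_distr[OF T(1) hm] T(2) by simp
qed

text \<open>The maximum of the Birkhoff sums of lengths 0 to \<open>n\<close>. The recursive form
  exposes the identity used below: where the maximum is positive, it equals \<open>g x\<close> plus
  the shorter maximum at \<open>T x\<close>.\<close>

fun running_max :: "('a \<Rightarrow> 'a) \<Rightarrow> ('a \<Rightarrow> real) \<Rightarrow> nat \<Rightarrow> 'a \<Rightarrow> real" where
  "running_max T g 0 x = 0"
| "running_max T g (Suc n) x = max 0 (g x + running_max T g n (T x))"

lemma running_max_nonneg: "running_max T g n x \<ge> 0"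
  by (cases n) auto

lemma running_max_mono: "running_max T g n x \<le> running_max T g (Suc n) x"
proof (induction n arbitrary: x)
  case (Suc n)
  have "running_max T g n (T x) \<le> running_max T g (Suc n) (T x)" by (rule Suc)
  then show ?case unfolding running_max.simps(2)[of T g n x] running_max.simps(2)[of T g "Suc n" x] by linarith
qed simp

lemma birkhoff_sum_Suc:
  fixes g :: "'a \<Rightarrow> real"
  shows "(\<Sum>k<Suc n. g ((T ^^ k) x)) = g x + (\<Sum>k<n. g ((T ^^ k) (T x)))"
  by (subst sum.lessThan_Suc_shift) (simp add: funpow_Suc_right del: funpow.simps)

lemma birkhoff_sum_le_running_max:
  "k \<le> n \<Longrightarrow> (\<Sum>j<k. g ((T ^^ j) x)) \<le> running_max T g n x"
proof (induction n arbitrary: x k)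
  case (Suc n)
  show ?case
  proof (cases k)
    case 0
    then show ?thesis by simp
  next
    case (Suc k')
    have "(\<Sum>j<k'. g ((T ^^ j) (T x))) \<le> running_max T g n (T x)"
      using Suc Suc.prems by (intro Suc.IH) auto
    then show ?thesis unfolding Suc birkhoff_sum_Suc by simp
  qed
qed simp

lemma running_max_integrable:
  fixes g :: "'a \<Rightarrow> real"
  assumes T: "T \<in> measurable M M" "distr M M T = M" and g: "integrable M g"
  shows "integrable M (running_max T g n)"
proof (induction n)
  case (Suc n)
  have "integrable M (\<lambda>x. running_max T g n (T x))"
    by (rule distr_integral_invariant[OF T]) (use Suc in simp)
  then show ?case using g by (auto intro!: integrable_max)
qed simp

text \<open>Garsia's argument: by invariance the maximum and its composition with \<open>T\<close>
  have the same integral, and their difference is at most \<open>g\<close> where the maximum is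
  positive and at most 0 elsewhere.\<close>

lemma maximal_ergodic:
  fixes g :: "'a \<Rightarrow> real"
  assumes T: "T \<in> measurable M M" "distr M M T = M" and g: "integrable M g"
  shows "0 \<le> (\<integral>x. indicator {x\<in>space M. running_max T g n x > 0} x * g x \<partial>M)"
proof (cases n)
  case (Suc n')
  let ?R = "running_max T g n"
  let ?E = "{x\<in>space M. ?R x > 0}"
  have R: "integrable M ?R" by (rule running_max_integrable[OF T g])
  have RT: "integrable M (\<lambda>x. ?R (T x))" "(\<integral>x. ?R (T x) \<partial>M) = (\<integral>x. ?R x \<partial>M)"
    by (rule distr_integral_invariant[OF T R])+
  have [measurable]: "?R \<in> borel_measurable M" using R by auto
  have E: "?E \<in> sets M" by measurable
  have "0 = (\<integral>x. ?R x - ?R (T x) \<partial>M)"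
    using R RT by simp
  also have "\<dots> \<le> (\<integral>x. indicator ?E x * g x \<partial>M)"
  proof (rule integral_mono)
    show "integrable M (\<lambda>x. ?R x - ?R (T x))" using R RT(1) by simp
    show "integrable M (\<lambda>x. indicator ?E x * g x)"
      using integrable_mult_indicator[OF E g] by simp
    fix x assume x: "x \<in> space M"
    show "?R x - ?R (T x) \<le> indicator ?E x * g x"
    proof (cases "?R x > 0")
      case True
      then have "?R x = g x + running_max T g n' (T x)" using Suc by (auto simp: max_def split: if_splits)
      moreover have "running_max T g n' (T x) \<le> ?R (T x)" using Suc running_max_mono by metis
      ultimately show ?thesis using True x by simp
    next
      case False
      then have "?R x = 0" using running_max_nonneg[of T g n x] by linarith
      then show ?thesis using running_max_nonneg[of T g n "T x"] by simp
    qed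
  qed
  finally show ?thesis .
qed simp

text \<open>The sets where \<open>running_max\<close> is positive exhaust almost all of the space as
  \<open>n\<close> grows, so the maximal inequality passes to the whole integral by dominated
  convergence.\<close>

lemma integral_nonneg_if_birkhoff_sum_pos:
  fixes g :: "'a \<Rightarrow> real"
  assumes T: "T \<in> measurable M M" "distr M M T = M" and g: "integrable M g"
    and pos: "AE x in M. \<exists>n. (\<Sum>k<n. g ((T ^^ k) x)) > 0"
  shows "0 \<le> (\<integral>x. g x \<partial>M)"
proof -
  let ?f = "\<lambda>n x. indicator {x\<in>space M. running_max T g n x > 0} x * g x"
  have [measurable]: "running_max T g n \<in> borel_measurable M" for n
    using running_max_integrable[OF T g] by auto
  have [measurable]: "g \<in> borel_measurable M" using g by auto
  have "(\<lambda>n. \<integral>x. ?f n x \<partial>M) \<longlonglongrightarrow> (\<integral>x. g x \<partial>M)"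
  proof (rule integral_dominated_convergence[where w="\<lambda>x. norm (g x)"])
    show "integrable M (\<lambda>x. norm (g x))" using g by simp
    show "AE x in M. (\<lambda>n. ?f n x) \<longlonglongrightarrow> g x"
      using pos AE_space
    proof eventually_elim
      case (elim x)
      then obtain n0 where n0: "(\<Sum>k<n0. g ((T ^^ k) x)) > 0" by blast
      have "eventually (\<lambda>n. ?f n x = g x) sequentially"
        using eventually_ge_at_top[of n0]
      proof eventually_elim
        case (elim n)
        have "running_max T g n x > 0"
          using birkhoff_sum_le_running_max[OF elim, of g T x] n0 by linarith
        then show ?case using \<open>x \<in> space M\<close> by simp
      qed
      then show ?case by (rule tendsto_eventually)
    qed
    show "AE x in M. norm (?f n x) \<le> norm (g x)" for n
      by (auto simp: indicator_def)
  qed measurable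
  then show ?thesis
    by (rule LIMSEQ_le_const) (use maximal_ergodic[OF T g] in auto)
qed

text \<open>The points whose sums for \<open>f - \<alpha>\<close> are unbounded above form an
  invariant set. If it had full measure, the previous lemma would make the integral of
  \<open>f - \<alpha>\<close> nonnegative, against the choice of \<open>\<alpha>\<close>; by
  ergodicity it is null.\<close>

lemma birkhoff_sum_bdd_above:
  fixes f :: "'a \<Rightarrow> real"
  assumes M: "prob_space M"
    and T: "T \<in> measurable M M" "distr M M T = M"
    and erg: "\<And>E. E \<in> sets M \<Longrightarrow> T -` E \<inter> space M = E \<Longrightarrow> measure M E = 0 \<or> measure M E = 1"
    and f: "f \<in> borel_measurable M" "\<And>x. \<bar>f x\<bar> \<le> B"
    and \<alpha>: "(\<integral>x. f x \<partial>M) < \<alpha>"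
  shows "AE x in M. \<exists>K. \<forall>n. (\<Sum>k<n. f ((T ^^ k) x) - \<alpha>) \<le> K"
proof -
  interpret prob_space M by fact
  define g where "g = (\<lambda>x. f x - \<alpha>)"
  have gb: "\<bar>g x\<bar> \<le> B + \<bar>\<alpha>\<bar>" for x using f(2)[of x] unfolding g_def by linarith
  have gm[measurable]: "g \<in> borel_measurable M" unfolding g_def using f(1) by simp
  have fi: "integrable M f" by (rule integrable_const_bound[where B=B]) (use f in auto)
  have gi: "integrable M g" unfolding g_def using fi by simp
  have ig: "(\<integral>x. g x \<partial>M) < 0" unfolding g_def using fi \<alpha> by (simp add: prob_space)
  define S where "S = (\<lambda>n x. \<Sum>k<n. g ((T ^^ k) x))"
  have [measurable]: "T ^^ k \<in> measurable M M" for k by (rule measurable_compose_n[OF T(1)])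
  have [measurable]: "S n \<in> borel_measurable M" for n unfolding S_def by measurable
  define E where "E = {x\<in>space M. \<forall>K::nat. \<exists>n. S n x > real K}"
  have Em: "E \<in> sets M" unfolding E_def by measurable
  have step: "S (Suc n) x = g x + S n (T x)" for n x
    unfolding S_def by (rule birkhoff_sum_Suc)
  \<comment> \<open>The sums at \<open>x\<close> and at \<open>T x\<close> differ by one term,
    bounded by \<open>c\<close>; starting from the threshold \<open>K + c\<close> absorbs it in both
    directions.\<close>
  obtain c :: nat where c: "B + \<bar>\<alpha>\<bar> \<le> real c" using real_arch_simple by blast
  have "T -` E \<inter> space M = E"
  proof (intro set_eqI iffI)
    fix x assume "x \<in> T -` E \<inter> space M"
    then have x: "x \<in> space M" and *: "\<And>K::nat. \<exists>n. S n (T x) > real K" by (auto simp: E_def)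
    have "\<exists>n. S n x > real K" for K
    proof -
      obtain n where "S n (T x) > real (K + c)" using * by blast
      then have "S (Suc n) x > real K" unfolding step using gb[of x] c by simp
      then show ?thesis by blast
    qed
    then show "x \<in> E" using x by (simp add: E_def)
  next
    fix x assume "x \<in> E"
    then have x: "x \<in> space M" and *: "\<And>K::nat. \<exists>n. S n x > real K" by (auto simp: E_def)
    have "\<exists>n. S n (T x) > real K" for K
    proof -
      obtain n where n: "S n x > real (K + c)" using * by blast
      \<comment> \<open>The empty sum is 0 and cannot exceed a nonnegative threshold, so
        \<open>n\<close> is a successor.\<close>
      then obtain n' where "n = Suc n'" by (cases n) (auto simp: S_def)
      then have "S n' (T x) > real K" using n step[of n' x] gb[of x] c by simp
      then show ?thesis by blast
    qed
    then show "x \<in> T -` E \<inter> space M" using x measurable_space[OF T(1) x] by (simp add: E_def)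
  qed
  from erg[OF Em this] have "prob E \<noteq> 1 \<Longrightarrow> prob E = 0" by blast
  moreover have "prob E \<noteq> 1"
  proof
    assume "prob E = 1"
    then have "AE x in M. x \<in> E" using Em AE_in_set_eq_1 by blast
    then have "AE x in M. \<forall>K::nat. \<exists>n. S n x > real K"
      by eventually_elim (simp add: E_def)
    then have "AE x in M. \<exists>n. S n x > 0"
      by eventually_elim (metis of_nat_0)
    then have "0 \<le> (\<integral>x. g x \<partial>M)"
      unfolding S_def by (rule integral_nonneg_if_birkhoff_sum_pos[OF T gi])
    then show False using ig by simp
  qed
  ultimately have "E \<in> null_sets M" using Em by (simp add: emeasure_eq_measure null_sets_def)
  then have "AE x in M. x \<notin> E" by (rule AE_not_in)
  then show ?thesis using AE_space
  proof eventually_elim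
    case (elim x)
    then obtain K :: nat where "\<And>n. S n x \<le> real K" by (auto simp: E_def not_less)
    then show ?case by (auto simp: S_def g_def)
  qed
qed

lemma birkhoff_average_eventually_less:
  fixes f :: "'a \<Rightarrow> real"
  assumes M: "prob_space M"
    and T: "T \<in> measurable M M" "distr M M T = M"
    and erg: "\<And>E. E \<in> sets M \<Longrightarrow> T -` E \<inter> space M = E \<Longrightarrow> measure M E = 0 \<or> measure M E = 1"
    and f: "f \<in> borel_measurable M" "\<And>x. \<bar>f x\<bar> \<le> B"
  shows "AE x in M. \<forall>e>0. eventually (\<lambda>n. (\<Sum>k<n. f ((T ^^ k) x)) / real n < (\<integral>x. f x \<partial>M) + e) sequentially"
proof -
  let ?I = "\<integral>x. f x \<partial>M"
  have "AE x in M. \<forall>j::nat. \<exists>K. \<forall>n. (\<Sum>k<n. f ((T ^^ k) x) - (?I + 1 / real (Suc j))) \<le> K"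
    unfolding AE_all_countable
    by (intro allI birkhoff_sum_bdd_above[OF M T erg f]) auto
  then show ?thesis
  proof eventually_elim
    case (elim x)
    show ?case
    proof (intro allI impI)
      fix e :: real assume "e > 0"
      \<comment> \<open>Half of \<open>e\<close> pays for raising the mean to a level at which the
        sums are bounded above, the other half for \<open>K / n\<close>.\<close>
      then obtain j where j: "1 / real (Suc j) < e / 2"
        using nat_approx_posE[of "e/2"] by auto
      obtain K where K: "\<And>n. (\<Sum>k<n. f ((T ^^ k) x) - (?I + 1 / real (Suc j))) \<le> K" using elim by blast
      have "((\<lambda>n. K / real n) \<longlonglongrightarrow> 0)" by (rule lim_const_over_n)
      then have "eventually (\<lambda>n. K / real n < e / 2) sequentially"
        using \<open>e > 0\<close> by (intro order_tendstoD(2)) auto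
      then show "eventually (\<lambda>n. (\<Sum>k<n. f ((T ^^ k) x)) / real n < ?I + e) sequentially"
        using eventually_gt_at_top[of 0]
      proof eventually_elim
        case (elim n)
        have "(\<Sum>k<n. f ((T ^^ k) x)) \<le> K + real n * (?I + 1 / real (Suc j))"
          using K[of n] by (simp add: sum_subtractf)
        then have "(\<Sum>k<n. f ((T ^^ k) x)) / real n \<le> (K + real n * (?I + 1 / real (Suc j))) / real n"
          by (rule divide_right_mono) simp
        also have "\<dots> = K / real n + (?I + 1 / real (Suc j))"
          using elim by (simp add: add_divide_distrib)
        also have "\<dots> < ?I + e" using elim j by linarith
        finally show ?case .
      qed
    qed
  qed
qed

text \<open>The lower estimate is the upper one applied to \<open>- f\<close>.\<close>

theorem birkhoff_ergodic:
  fixes f :: "'a \<Rightarrow> real"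
  assumes M: "prob_space M"
    and T: "T \<in> measurable M M" "distr M M T = M"
    and erg: "\<And>E. E \<in> sets M \<Longrightarrow> T -` E \<inter> space M = E \<Longrightarrow> measure M E = 0 \<or> measure M E = 1"
    and f: "f \<in> borel_measurable M" "\<And>x. \<bar>f x\<bar> \<le> B"
  shows "AE x in M. (\<lambda>n. (\<Sum>k<n. f ((T ^^ k) x)) / real n) \<longlonglongrightarrow> (\<integral>x. f x \<partial>M)"
proof -
  have "AE x in M. \<forall>e>0. eventually (\<lambda>n. (\<Sum>k<n. - f ((T ^^ k) x)) / real n < (\<integral>x. - f x \<partial>M) + e) sequentially"
    by (rule birkhoff_average_eventually_less[OF M T erg, where B=B]) (use f in auto)
  with birkhoff_average_eventually_less[OF M T erg f, simplified] show ?thesis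
  proof eventually_elim
    case (elim x)
    show ?case
    proof (rule tendstoI)
      fix e :: real assume e: "e > 0"
      have "eventually (\<lambda>n. (\<Sum>k<n. f ((T ^^ k) x)) / real n < (\<integral>x. f x \<partial>M) + e) sequentially"
        "eventually (\<lambda>n. (\<Sum>k<n. - f ((T ^^ k) x)) / real n < (\<integral>x. - f x \<partial>M) + e) sequentially"
        using elim e by blast+
      then show "eventually (\<lambda>n. dist ((\<Sum>k<n. f ((T ^^ k) x)) / real n) (\<integral>x. f x \<partial>M) < e) sequentially"
        by eventually_elim (auto simp: dist_real_def sum_negf)
    qed
  qed
qed

section \<open>Continued fractions\<close>

text \<open>The inverse branch of an iterate of the Gauss map with digits \<open>u\<close>: a
  continued fraction whose remainder \<open>t\<close> may be any real number, not only a finite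
  expansion.\<close>

definition cf_tail :: "nat list \<Rightarrow> real \<Rightarrow> real" where
  "cf_tail u t = foldr (\<lambda>a t. 1 / (real a + t)) u t"

lemma cf_fin_append: "cf_fin (u @ v) = cf_tail u (cf_fin v)"
  by (induction u) (auto simp: cf_tail_def)

lemma cf_tail_range:
  assumes "\<forall>a\<in>set u. a \<ge> 1" "0 \<le> t" "t \<le> 1"
  shows "0 \<le> cf_tail u t" "cf_tail u t \<le> 1"
proof -
  have "0 \<le> cf_tail u t \<and> cf_tail u t \<le> 1"
    using assms
  proof (induction u)
    case (Cons a u)
    then have "0 \<le> cf_tail u t" "real a \<ge> 1" by auto
    then show ?case by (simp add: cf_tail_def)
  qed (simp add: cf_tail_def)
  then show "0 \<le> cf_tail u t" "cf_tail u t \<le> 1" by auto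
qed

lemma cf_step_diff:
  fixes a t t' :: real
  assumes "a \<ge> 1" "t \<ge> 0" "t' \<ge> 0"
  shows "\<bar>1 / (a + t) - 1 / (a + t')\<bar> = \<bar>t - t'\<bar> / ((a + t) * (a + t'))"
proof -
  have "1 / (a + t) - 1 / (a + t') = (t' - t) / ((a + t) * (a + t'))"
    using assms by (simp add: diff_frac_eq)
  then show ?thesis using assms by (simp add: abs_mult abs_divide)
qed

text \<open>One step \<open>t \<mapsto> 1 / (a + t)\<close> need not contract (\<open>a = 1\<close>, \<open>t = 0\<close>), but two steps
  contract by the factor \<open>1 / 4\<close>.\<close>

lemma cf_tail_diff:
  assumes "\<forall>a\<in>set u. a \<ge> 1" "0 \<le> t" "t \<le> 1" "0 \<le> t'" "t' \<le> 1"
  shows "\<bar>cf_tail u t - cf_tail u t'\<bar> \<le> 2 / 2 ^ length u"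
  using assms
proof (induction "length u" arbitrary: u rule: less_induct)
  case less
  \<comment> \<open>The induction removes two digits at a time and so has two base cases. The
    numerator 2 makes the bound equal to 1 for a single digit, where only the diameter of the unit
    interval is available.\<close>
  consider "u = []" | a where "u = [a]" | a b v where "u = a # b # v"
    by (metis list.exhaust)
  then show ?case
  proof cases
    case 1
    then show ?thesis using less.prems by (auto simp: cf_tail_def)
  next
    case 2
    then show ?thesis using less.prems cf_tail_range[of u t] cf_tail_range[of u t'] by auto
  next
    case 3
    let ?x = "cf_tail v t" and ?y = "cf_tail v t'"
    have ih: "\<bar>?x - ?y\<bar> \<le> 2 / 2 ^ length v"
      using 3 less.prems by (intro less.hyps) auto
    have r: "0 \<le> ?x" "0 \<le> ?y" using cf_tail_range[of v t] cf_tail_range[of v t'] 3 less.prems by auto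
    have ab: "real a \<ge> 1" "real b \<ge> 1" using 3 less.prems by auto
    define x' where "x' = 1 / (real b + ?x)"
    define y' where "y' = 1 / (real b + ?y)"
    have p: "x' \<ge> 0" "y' \<ge> 0" unfolding x'_def y'_def using r ab by auto
    have bx: "real b + ?x > 0" "real b + ?y > 0" using r ab by linarith+
    have "\<bar>cf_tail u t - cf_tail u t'\<bar> = \<bar>1 / (real a + x') - 1 / (real a + y')\<bar>"
      by (simp add: 3 cf_tail_def x'_def y'_def)
    also have "\<dots> = \<bar>x' - y'\<bar> / ((real a + x') * (real a + y'))"
      by (rule cf_step_diff) (use ab p in auto)
    also have "\<bar>x' - y'\<bar> = \<bar>?x - ?y\<bar> / ((real b + ?x) * (real b + ?y))"
      unfolding x'_def y'_def by (rule cf_step_diff) (use ab r in auto)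
    also have "\<bar>?x - ?y\<bar> / ((real b + ?x) * (real b + ?y)) / ((real a + x') * (real a + y')) =
        \<bar>?x - ?y\<bar> / (((real a + x') * (real b + ?x)) * ((real a + y') * (real b + ?y)))"
      by (simp add: mult_ac)
    also have "\<dots> \<le> \<bar>?x - ?y\<bar> / 4"
    proof (rule divide_left_mono)
      \<comment> \<open>The two denominators of a double step multiply to
        \<open>a * (b + q) + 1\<close>, which is at least 2; one such factor for each of the two
        points gives 4.\<close>
      have k: "(real a + 1 / (real b + q)) * (real b + q) \<ge> 2" if "q \<ge> 0" for q
      proof -
        have "(real a + 1 / (real b + q)) * (real b + q) = real a * (real b + q) + 1"
          using that ab by (simp add: field_simps)
        moreover have "1 * 1 \<le> real a * (real b + q)" by (rule mult_mono) (use ab that in auto)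
        ultimately show ?thesis by simp
      qed
      have "2 * 2 \<le> ((real a + x') * (real b + ?x)) * ((real a + y') * (real b + ?y))"
        by (rule mult_mono) (use k[of ?x] k[of ?y] r in \<open>auto simp: x'_def y'_def\<close>)
      then show 4: "4 \<le> ((real a + x') * (real b + ?x)) * ((real a + y') * (real b + ?y))" by simp
      show "0 < (real a + x') * (real b + ?x) * ((real a + y') * (real b + ?y)) * 4" using 4 by linarith
    qed auto
    also have "\<dots> \<le> 2 / 2 ^ length v / 4" using ih by (rule divide_right_mono) simp
    also have "\<dots> = 2 / 2 ^ length u" by (simp add: 3)
    finally show ?thesis .
  qed
qed

section \<open>Convergence and uniqueness of infinite continued fractions\<close>

lemma cf_error_LIMSEQ: "(\<lambda>n. 2 / 2 ^ n :: real) \<longlonglongrightarrow> 0"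
  using tendsto_mult_right_zero[OF LIMSEQ_realpow_zero[of "1/2::real"], of 2] by (simp add: power_divide)

context
  fixes w :: "nat \<Rightarrow> nat"
  assumes w: "\<And>i. w i \<ge> 1"
begin

lemma cf_fin_prefix_range: "0 \<le> cf_fin (map w xs)" "cf_fin (map w xs) \<le> 1"
  using cf_tail_range[of "map w xs" 0] w cf_fin_append[of "map w xs" "[]"] by auto

lemma cf_fin_prefix_diff:
  assumes "n \<le> k"
  shows "\<bar>cf_fin (map w [0..<k]) - cf_fin (map w [0..<n])\<bar> \<le> 2 / 2 ^ n"
proof -
  have "[0..<k] = [0..<n] @ [n..<k]" using assms upt_add_eq_append[of 0 n "k - n"] by simp
  then have "cf_fin (map w [0..<k]) = cf_tail (map w [0..<n]) (cf_fin (map w [n..<k]))"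
    by (simp add: cf_fin_append)
  moreover have "cf_fin (map w [0..<n]) = cf_tail (map w [0..<n]) 0"
    using cf_fin_append[of "map w [0..<n]" "[]"] by simp
  ultimately show ?thesis
    using cf_tail_diff[of "map w [0..<n]" "cf_fin (map w [n..<k])" 0] w cf_fin_prefix_range by auto
qed

lemma cf_inf_LIMSEQ: "(\<lambda>n. cf_fin (map w [0..<n])) \<longlonglongrightarrow> cf_inf w"
proof -
  have "Cauchy (\<lambda>n. cf_fin (map w [0..<n]))"
  proof (rule metric_CauchyI)
    fix e :: real assume "e > 0"
    then obtain N where N: "\<And>n. n \<ge> N \<Longrightarrow> 2 / 2 ^ n < e / 2"
      using order_tendstoD(2)[OF cf_error_LIMSEQ, of "e/2"] unfolding eventually_sequentially by auto
    have "dist (cf_fin (map w [0..<i])) (cf_fin (map w [0..<j])) < e" if "i \<ge> N" "j \<ge> N" for i j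
      using cf_fin_prefix_diff[OF that(1)] cf_fin_prefix_diff[OF that(2)] N[of N]
      unfolding dist_real_def by simp
    then show "\<exists>N. \<forall>i\<ge>N. \<forall>j\<ge>N. dist (cf_fin (map w [0..<i])) (cf_fin (map w [0..<j])) < e" by blast
  qed
  then show ?thesis unfolding cf_inf_def by (simp add: Cauchy_convergent_iff convergent_LIMSEQ_iff)
qed

lemma cf_inf_diff: "\<bar>cf_inf w - cf_fin (map w [0..<n])\<bar> \<le> 2 / 2 ^ n"
proof (rule tendsto_upperbound)
  show "(\<lambda>k. \<bar>cf_fin (map w [0..<k]) - cf_fin (map w [0..<n])\<bar>) \<longlonglongrightarrow> \<bar>cf_inf w - cf_fin (map w [0..<n])\<bar>"
    by (intro tendsto_intros cf_inf_LIMSEQ)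
  show "eventually (\<lambda>k. \<bar>cf_fin (map w [0..<k]) - cf_fin (map w [0..<n])\<bar> \<le> 2 / 2 ^ n) sequentially"
    using eventually_ge_at_top[of n] by eventually_elim (rule cf_fin_prefix_diff)
qed simp

lemma cf_inf_range: "0 \<le> cf_inf w" "cf_inf w \<le> 1"
  by (rule LIMSEQ_le_const[OF cf_inf_LIMSEQ] LIMSEQ_le_const2[OF cf_inf_LIMSEQ],
      use cf_fin_prefix_range in blast)+

end

lemma cf_inf_Suc:
  assumes w: "\<And>i. w i \<ge> 1"
  shows "cf_inf w = 1 / (real (w 0) + cf_inf (\<lambda>i. w (Suc i)))"
proof -
  have w1: "real (w 0) \<ge> 1" using w[of 0] by linarith
  have "(\<lambda>n. cf_fin (map w [0..<Suc n])) \<longlonglongrightarrow> cf_inf w"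
    using cf_inf_LIMSEQ[OF w] by (rule LIMSEQ_Suc)
  moreover have "cf_fin (map w [0..<Suc n]) = 1 / (real (w 0) + cf_fin (map (\<lambda>i. w (Suc i)) [0..<n]))" for n
    by (subst upt_conv_Cons, simp, subst map_Suc_upt[symmetric], simp add: comp_def del: map_Suc_upt)
  moreover have "(\<lambda>n. 1 / (real (w 0) + cf_fin (map (\<lambda>i. w (Suc i)) [0..<n]))) \<longlonglongrightarrow> 1 / (real (w 0) + cf_inf (\<lambda>i. w (Suc i)))"
    using w1 cf_inf_range(1)[of "\<lambda>i. w (Suc i)", OF w]
    by (intro tendsto_intros cf_inf_LIMSEQ w) linarith
  ultimately show ?thesis using LIMSEQ_unique by auto
qed

text \<open>Strictness is what lets the floor of the reciprocal read off the first digit.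
  Positivity, applied to the tail, yields the upper bound.\<close>

lemma cf_inf_strict:
  assumes w: "\<And>i. w i \<ge> 1"
  shows "0 < cf_inf w" "cf_inf w < 1"
proof -
  have pos: "0 < cf_inf v" if "\<And>i. v i \<ge> 1" for v
  proof -
    have "real (v 0) \<ge> 1" using that[of 0] by linarith
    then have "0 < real (v 0) + cf_inf (\<lambda>i. v (Suc i))"
      using cf_inf_range(1)[of "\<lambda>i. v (Suc i)", OF that] by linarith
    then show ?thesis by (subst cf_inf_Suc[OF that]) simp
  qed
  show "0 < cf_inf w" by (rule pos) (rule w)
  have "real (w 0) \<ge> 1" "0 < cf_inf (\<lambda>i. w (Suc i))" using w[of 0] pos w by auto
  then show "cf_inf w < 1" by (subst cf_inf_Suc[OF w]) (auto simp: field_simps)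
qed

lemma inverse_cf_inf:
  assumes w: "\<And>i. w i \<ge> 1"
  shows "1 / cf_inf w = real (w 0) + cf_inf (\<lambda>i. w (Suc i))"
  by (subst cf_inf_Suc[OF w]) simp

lemma floor_inverse_cf_inf:
  assumes w: "\<And>i. w i \<ge> 1"
  shows "\<lfloor>1 / cf_inf w\<rfloor> = int (w 0)"
  unfolding inverse_cf_inf[OF w] using cf_inf_strict[of "\<lambda>i. w (Suc i)"] w
  by (intro floor_unique) auto

lemma gauss_map_cf_inf:
  assumes w: "\<And>i. w i \<ge> 1"
  shows "gauss_map (cf_inf w) = cf_inf (\<lambda>i. w (Suc i))"
  using floor_inverse_cf_inf[OF w] inverse_cf_inf[OF w] unfolding gauss_map_def frac_def by simp

lemma gauss_map_funpow_cf_inf: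
  assumes w: "\<And>i. w i \<ge> 1"
  shows "(gauss_map ^^ n) (cf_inf w) = cf_inf (\<lambda>i. w (n + i))"
proof (induction n)
  case (Suc n)
  then show ?case using gauss_map_cf_inf[of "\<lambda>i. w (n + i)"] w by simp
qed simp

text \<open>An explicit formula for the digits, total and Borel in \<open>x\<close>, which recovers
  every positive sequence from its value.\<close>

definition gauss_digit :: "real \<Rightarrow> nat \<Rightarrow> nat" where
  "gauss_digit x i = nat \<lfloor>1 / (gauss_map ^^ i) x\<rfloor>"

lemma gauss_digit_cf_inf:
  assumes w: "\<And>i. w i \<ge> 1"
  shows "gauss_digit (cf_inf w) = w"
proof
  fix i
  show "gauss_digit (cf_inf w) i = w i"
    unfolding gauss_digit_def gauss_map_funpow_cf_inf[OF w]
    using floor_inverse_cf_inf[of "\<lambda>j. w (i + j)"] w by simp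
qed

text \<open>\<open>gauss_digit\<close> is a left inverse of \<open>cf_inf\<close> on positive
  sequences, and this gives the uniqueness that the definite description requires.\<close>

lemma cf_digits_cf_inf:
  assumes w: "\<And>i. w i \<ge> 1"
  shows "cf_digits (cf_inf w) = w"
  unfolding cf_digits_def
proof (rule the_equality)
  show "(\<forall>i. w i \<ge> 1) \<and> cf_inf w = cf_inf w" using w by simp
  fix v assume v: "(\<forall>i. 1 \<le> v i) \<and> cf_inf v = cf_inf w"
  then show "v = w" using gauss_digit_cf_inf[of v] gauss_digit_cf_inf[OF w] by auto
qed

lemma cf_T_cf_inf:
  assumes w: "\<And>i. w i \<ge> 1"
  shows "cf_T n (cf_inf w) = cf_inf (\<lambda>i. w (n + i))"
  by (simp add: cf_T_def cf_digits_cf_inf[OF w])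

lemma rev_upt_map: "rev (map w [0..<n]) = map (\<lambda>i. w (n - 1 - i)) [0..<n]"
  by (rule nth_equalityI) (auto simp: rev_nth)

lemma cf_V_cf_inf:
  assumes w: "\<And>i. w i \<ge> 1"
  shows "cf_V n (cf_inf w) = cf_fin (map (\<lambda>i. w (n - 1 - i)) [0..<n])"
  by (simp add: cf_V_def cf_digits_cf_inf[OF w] rev_upt_map)

section \<open>Measurability of expansions and digits\<close>

lemma cf_fin_measurable:
  assumes "\<And>i. i \<in> set xs \<Longrightarrow> f i \<in> measurable M (count_space UNIV)"
  shows "(\<lambda>x. cf_fin (map (\<lambda>i. f i x) xs)) \<in> borel_measurable M"
  using assms
proof (induction xs)
  case (Cons a xs)
  have [measurable]: "f a \<in> measurable M (count_space UNIV)" "(\<lambda>x. cf_fin (map (\<lambda>i. f i x) xs)) \<in> borel_measurable M"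
    using Cons by auto
  show ?case unfolding list.map cf_fin.simps by measurable
qed simp

lemma cf_inf_measurable:
  assumes "\<And>i. f i \<in> measurable M (count_space UNIV)"
  shows "(\<lambda>x. cf_inf (\<lambda>i. f i x)) \<in> borel_measurable M"
  unfolding cf_inf_def by (intro borel_measurable_lim_metric cf_fin_measurable assms)

lemma gauss_map_measurable [measurable]: "gauss_map \<in> borel_measurable borel"
  unfolding gauss_map_def frac_def by measurable

lemma gauss_digit_measurable [measurable]: "(\<lambda>x. gauss_digit x i) \<in> measurable borel (count_space UNIV)"
proof -
  have [measurable]: "gauss_map ^^ i \<in> measurable borel borel" by (rule measurable_compose_n) measurable
  show ?thesis unfolding gauss_digit_def by measurable
qed

section \<open>Quasi-Bernoulli measures on the two-sided shift\<close>

lemma space_code_space: "space code_space = {\<tau>. \<forall>i. \<tau> i \<ge> 1}"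
  by (auto simp: code_space_def space_PiM PiE_UNIV_domain)

lemma coordinate_measurable [measurable]: "(\<lambda>\<tau>. \<tau> i) \<in> measurable code_space (count_space UNIV)"
proof -
  have "(\<lambda>\<tau>. \<tau> i) \<in> measurable code_space (count_space {1..})"
    unfolding code_space_def by (rule measurable_component_singleton) simp
  then show ?thesis
    by (rule measurable_compose) simp
qed

lemma left_shift_measurable [measurable]: "left_shift \<in> measurable code_space code_space"
proof -
  have "(\<lambda>\<tau> i. \<tau> (i + 1)) \<in> measurable code_space (\<Pi>\<^sub>M i\<in>UNIV. count_space {1::nat..})"
  proof (rule measurable_PiM_single')
    show "(\<lambda>\<tau>. \<tau> (i + 1)) \<in> measurable code_space (count_space {1..})" for i :: int
      unfolding code_space_def by (rule measurable_component_singleton) simp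
    show "(\<lambda>\<tau> i. \<tau> (i + 1)) \<in> space code_space \<rightarrow> (\<Pi>\<^sub>E i\<in>UNIV. space (count_space {1::nat..}))"
      by (auto simp: space_code_space PiE_UNIV_domain)
  qed
  then show ?thesis by (simp add: code_space_def left_shift_def[abs_def])
qed

lemma left_shift_funpow: "(left_shift ^^ n) \<tau> = (\<lambda>i. \<tau> (i + int n))"
  by (induction n) (auto simp: left_shift_def fun_eq_iff algebra_simps)

section \<open>Cylinders and sets depending on finitely many coordinates\<close>

definition cylinder :: "int \<Rightarrow> nat list \<Rightarrow> (int \<Rightarrow> nat) set" where
  "cylinder k u = {\<tau> \<in> space code_space. \<forall>j<length u. \<tau> (k + int j) = u ! j}"

definition words :: "nat \<Rightarrow> nat list set" where
  "words n = {u. length u = n \<and> (\<forall>a\<in>set u. a \<ge> 1)}"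

lemma countable_words [simp]: "countable U" for U :: "nat list set"
  by (rule countableI_type)

lemma cylinder_sets [measurable]: "cylinder k u \<in> sets code_space"
  unfolding cylinder_def by measurable

lemma cylinder_Nil [simp]: "cylinder k [] = space code_space"
  by (simp add: cylinder_def)

lemma cylinder_append: "cylinder k (u @ v) = cylinder k u \<inter> cylinder (k + int (length u)) v"
proof (intro set_eqI iffI)
  fix \<tau> assume *: "\<tau> \<in> cylinder k (u @ v)"
  have "\<tau> (k + int (length u) + int j) = v ! j" if "j < length v" for j
    using * that by (auto simp: cylinder_def nth_append dest!: spec[of _ "length u + j"] simp: add.assoc)
  then show "\<tau> \<in> cylinder k u \<inter> cylinder (k + int (length u)) v"
    using * by (auto simp: cylinder_def nth_append dest: spec)
next
  fix \<tau> assume *: "\<tau> \<in> cylinder k u \<inter> cylinder (k + int (length u)) v"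
  have "\<tau> (k + int j) = (u @ v) ! j" if "j < length (u @ v)" for j
  proof (cases "j < length u")
    case False
    have "\<forall>j<length v. \<tau> (k + int (length u) + int j) = v ! j" using * by (simp add: cylinder_def)
    moreover have "j - length u < length v" using that False by simp
    ultimately have "\<tau> (k + int (length u) + int (j - length u)) = v ! (j - length u)" by blast
    moreover have "k + int (length u) + int (j - length u) = k + int j" using False by (simp add: of_nat_diff)
    ultimately show ?thesis using False by (simp add: nth_append)
  qed (use * in \<open>auto simp: cylinder_def nth_append\<close>)
  then show "\<tau> \<in> cylinder k (u @ v)" using * by (auto simp: cylinder_def)
qed

lemma cylinder_disjoint:
  assumes "length u = length v" "u \<noteq> v"
  shows "cylinder k u \<inter> cylinder k v = {}"
proof -
  obtain j where "j < length u" "u ! j \<noteq> v ! j" using assms nth_equalityI by blast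
  then show ?thesis using assms(1) by (fastforce simp: cylinder_def)
qed

lemma disjoint_family_cylinder: "U \<subseteq> words n \<Longrightarrow> disjoint_family_on (cylinder k) U"
  by (auto simp: disjoint_family_on_def words_def subset_eq intro!: cylinder_disjoint)

lemma shift_vimage_cylinder:
  "(left_shift ^^ n) -` cylinder k u \<inter> space code_space = cylinder (k + int n) u"
  by (auto simp: cylinder_def left_shift_funpow space_code_space algebra_simps)

text \<open>The window is half open and has length \<open>2 * r\<close>, so that its translates by
  multiples of \<open>2 * r\<close> abut without overlap. One implication suffices, as the two
  sequences may be exchanged.\<close>

definition window_determined :: "nat \<Rightarrow> (int \<Rightarrow> nat) set \<Rightarrow> bool" where
  "window_determined r V \<longleftrightarrow> V \<subseteq> space code_space \<and>
     (\<forall>\<tau>\<in>space code_space. \<forall>\<tau>'\<in>space code_space.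
        (\<forall>i. - int r \<le> i \<and> i < int r \<longrightarrow> \<tau> i = \<tau>' i) \<longrightarrow> \<tau> \<in> V \<longrightarrow> \<tau>' \<in> V)"

lemma window_determinedI:
  assumes "V \<subseteq> space code_space"
    and "\<And>\<tau> \<tau>'. \<tau> \<in> V \<Longrightarrow> \<tau>' \<in> space code_space \<Longrightarrow> (\<And>i. - int r \<le> i \<Longrightarrow> i < int r \<Longrightarrow> \<tau> i = \<tau>' i) \<Longrightarrow> \<tau>' \<in> V"
  shows "window_determined r V"
  using assms unfolding window_determined_def by simp

lemma window_determinedD:
  assumes "window_determined r V" "\<tau> \<in> V" "\<tau>' \<in> space code_space"
    and "\<And>i. - int r \<le> i \<Longrightarrow> i < int r \<Longrightarrow> \<tau> i = \<tau>' i"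
  shows "\<tau>' \<in> V"
proof -
  have "\<tau> \<in> space code_space" using assms(1,2) by (auto simp: window_determined_def)
  moreover have "\<forall>i. - int r \<le> i \<and> i < int r \<longrightarrow> \<tau> i = \<tau>' i" using assms(4) by blast
  ultimately show ?thesis using assms(1-3) unfolding window_determined_def by blast
qed

lemma window_determined_subset: "window_determined r V \<Longrightarrow> V \<subseteq> space code_space"
  by (simp add: window_determined_def)

lemma window_determined_mono:
  assumes V: "window_determined r V" and r: "r \<le> r'"
  shows "window_determined r' V"
proof (rule window_determinedI)
  fix \<tau> \<tau>' assume t: "\<tau> \<in> V" "\<tau>' \<in> space code_space" and eq: "\<And>i. - int r' \<le> i \<Longrightarrow> i < int r' \<Longrightarrow> \<tau> i = \<tau>' i"
  show "\<tau>' \<in> V"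
    by (rule window_determinedD[OF V t]) (use r in \<open>auto intro!: eq\<close>)
qed (rule window_determined_subset[OF V])

lemma window_determined_Un:
  assumes V: "window_determined r V" and W: "window_determined r W"
  shows "window_determined r (V \<union> W)"
proof (rule window_determinedI)
  fix \<tau> \<tau>' assume t: "\<tau> \<in> V \<union> W" "\<tau>' \<in> space code_space" and eq: "\<And>i. - int r \<le> i \<Longrightarrow> i < int r \<Longrightarrow> \<tau> i = \<tau>' i"
  show "\<tau>' \<in> V \<union> W"
    using t(1) window_determinedD[OF V _ t(2) eq] window_determinedD[OF W _ t(2) eq] by blast
qed (use window_determined_subset V W in blast)

lemma window_determined_Diff:
  assumes V: "window_determined r V"
  shows "window_determined r (space code_space - V)"
proof (rule window_determinedI)
  fix \<tau> \<tau>' assume t: "\<tau> \<in> space code_space - V" "\<tau>' \<in> space code_space" and eq: "\<And>i. - int r \<le> i \<Longrightarrow> i < int r \<Longrightarrow> \<tau> i = \<tau>' i"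
  show "\<tau>' \<in> space code_space - V"
    using t window_determinedD[OF V, of \<tau>' \<tau>] eq by auto
qed blast

lemma window_determined_eq_cylinders:
  assumes V: "window_determined r V"
  shows "V = (\<Union>u\<in>{u \<in> words (2 * r). cylinder (- int r) u \<subseteq> V}. cylinder (- int r) u)"
proof (intro equalityI subsetI)
  fix \<tau> assume t: "\<tau> \<in> V"
  then have ts: "\<tau> \<in> space code_space" using V by (auto simp: window_determined_def)
  define u where "u = map (\<lambda>j. \<tau> (- int r + int j)) [0..<2 * r]"
  have u: "u \<in> words (2 * r)" using ts by (auto simp: words_def u_def space_code_space)
  have "\<tau> \<in> cylinder (- int r) u" using ts by (auto simp: cylinder_def u_def)
  moreover have "cylinder (- int r) u \<subseteq> V"
  proof
    fix \<tau>' assume *: "\<tau>' \<in> cylinder (- int r) u"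
    have "\<tau> i = \<tau>' i" if "- int r \<le> i \<and> i < int r" for i
    proof -
      have "nat (i + int r) < 2 * r" "- int r + int (nat (i + int r)) = i" using that by auto
      then show ?thesis using * by (auto simp: cylinder_def u_def dest!: spec[of _ "nat (i + int r)"])
    qed
    then show "\<tau>' \<in> V"
      by (rule window_determinedD[OF V t, rotated]) (use * in \<open>auto simp: cylinder_def\<close>)
  qed
  ultimately show "\<tau> \<in> (\<Union>u\<in>{u \<in> words (2 * r). cylinder (- int r) u \<subseteq> V}. cylinder (- int r) u)"
    using u by blast
qed blast

text \<open>There are only countably many words of a given length, so a set that depends on a finite
  window is automatically measurable.\<close>

lemma window_determined_sets:
  assumes V: "window_determined r V"
  shows "V \<in> sets code_space"
  by (subst window_determined_eq_cylinders[OF V]) (intro sets.countable_UN'; auto)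

section \<open>Shift-invariant measures and approximation by finite windows\<close>

locale shift_measure = prob_space m for m :: "(int \<Rightarrow> nat) measure" +
  assumes sets_m: "sets m = sets code_space"
    and shift_m: "distr m code_space left_shift = m"
begin

lemma space_m: "space m = space code_space"
  using sets_m by (rule sets_eq_imp_space_eq)

lemma measurable_m: "measurable m N = measurable code_space N"
  by (rule measurable_cong_sets[OF sets_m refl])

lemma shift_measurable_m: "left_shift \<in> measurable m m"
  using left_shift_measurable measurable_cong_sets[OF sets_m sets_m] by simp

lemma shift_distr_m: "distr m m left_shift = m"
proof -
  have "distr m m left_shift = distr m code_space left_shift" by (rule distr_cong) (auto simp: sets_m)
  then show ?thesis using shift_m by simp
qed

lemma shift_funpow_measurable: "left_shift ^^ n \<in> measurable m m"
  by (rule measurable_compose_n[OF shift_measurable_m])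

lemma measure_shift_vimage:
  assumes A: "A \<in> sets m"
  shows "measure m ((left_shift ^^ n) -` A \<inter> space m) = measure m A"
proof (induction n)
  case 0
  then show ?case using sets.sets_into_space[OF A] by (simp add: Int_absorb2)
next
  case (Suc n)
  let ?B = "(left_shift ^^ n) -` A \<inter> space m"
  have B: "?B \<in> sets m" using shift_funpow_measurable A by (rule measurable_sets)
  have "(left_shift ^^ Suc n) -` A \<inter> space m = left_shift -` ?B \<inter> space m"
    using measurable_space[OF shift_measurable_m] by (auto simp: funpow_Suc_right simp del: funpow.simps)
  also have "measure m \<dots> = measure (distr m m left_shift) ?B"
    using measure_distr[OF shift_measurable_m B] by simp
  also have "\<dots> = measure m A" unfolding shift_distr_m by (rule Suc)
  finally show ?case .
qed

text \<open>Only nonnegative powers of the shift are at hand, so for negative \<open>k\<close> it is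
  the cylinder at \<open>k\<close> that is pulled back to 0.\<close>

lemma measure_cylinder: "measure m (cylinder k u) = measure m (cylinder 0 u)"
proof (cases "k \<ge> 0")
  case True
  then show ?thesis
    using measure_shift_vimage[of "cylinder 0 u" "nat k"] shift_vimage_cylinder[of "nat k" 0 u]
    by (simp add: sets_m space_m cylinder_sets)
next
  case False
  then show ?thesis
    using measure_shift_vimage[of "cylinder k u" "nat (- k)"] shift_vimage_cylinder[of "nat (- k)" k u]
    by (simp add: sets_m space_m cylinder_sets)
qed

text \<open>The errors of the single approximations add up, and halving the tolerance at each new
  set keeps their sum below \<open>e\<close>.\<close>

lemma approx_finite_union:
  fixes a :: "nat \<Rightarrow> (int \<Rightarrow> nat) set"
  assumes a: "\<And>i. a i \<in> sets m"
    and ap: "\<And>i e. e > 0 \<Longrightarrow> \<exists>r V. window_determined r V \<and> prob (V - a i) + prob (a i - V) < e"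
    and "(e::real) > 0"
  shows "\<exists>r V. window_determined r V \<and> prob (V - (\<Union>i<N. a i)) + prob ((\<Union>i<N. a i) - V) < e"
  using \<open>e > 0\<close>
proof (induction N arbitrary: e)
  case 0
  have "window_determined 0 {}" by (simp add: window_determined_def)
  then show ?case using 0 by (intro exI[of _ 0] exI[of _ "{}"]) simp
next
  case (Suc N)
  obtain r V where V: "window_determined r V" "prob (V - (\<Union>i<N. a i)) + prob ((\<Union>i<N. a i) - V) < e / 2"
    using Suc.IH[of "e/2"] Suc.prems by auto
  obtain r' W where W: "window_determined r' W" "prob (W - a N) + prob (a N - W) < e / 2"
    using ap[of "e/2" N] Suc.prems by auto
  let ?A = "\<Union>i<N. a i"
  have [measurable]: "V \<in> sets m" "W \<in> sets m" "?A \<in> sets m" "a N \<in> sets m"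
    using V W window_determined_sets a by (auto simp: sets_m)
  have "window_determined (max r r') (V \<union> W)"
    using V W by (intro window_determined_Un) (auto elim: window_determined_mono)
  moreover have "prob ((V \<union> W) - (\<Union>i<Suc N. a i)) \<le> prob (V - ?A) + prob (W - a N)"
  proof -
    have "prob ((V \<union> W) - (\<Union>i<Suc N. a i)) \<le> prob ((V - ?A) \<union> (W - a N))"
      by (rule finite_measure_mono) (auto simp: lessThan_Suc)
    also have "\<dots> \<le> prob (V - ?A) + prob (W - a N)" by (rule measure_Un_le) measurable
    finally show ?thesis .
  qed
  moreover have "prob ((\<Union>i<Suc N. a i) - (V \<union> W)) \<le> prob (?A - V) + prob (a N - W)"
  proof -
    have "prob ((\<Union>i<Suc N. a i) - (V \<union> W)) \<le> prob ((?A - V) \<union> (a N - W))"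
      by (rule finite_measure_mono) (auto simp: lessThan_Suc)
    also have "\<dots> \<le> prob (?A - V) + prob (a N - W)" by (rule measure_Un_le) measurable
    finally show ?thesis .
  qed
  ultimately show ?case using V(2) W(2) by (intro exI[of _ "max r r'"] exI[of _ "V \<union> W"]) auto
qed

text \<open>The sets with arbitrarily good approximations contain the coordinate generators and are
  closed under complements and countable unions, so induction over the generated sigma-algebra
  reaches every measurable set.\<close>

lemma approx_window_determined:
  assumes "E \<in> sets m" "e > 0"
  shows "\<exists>r V. window_determined r V \<and> prob (V - E) + prob (E - V) < e"
proof -
  let ?\<Omega> = "space code_space"
  let ?G = "{{f\<in>\<Pi>\<^sub>E i\<in>UNIV. space (count_space {1::nat..}). f i \<in> A} | (i::int) A. i \<in> UNIV \<and> A \<in> sets (count_space {1::nat..})}"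
  have \<Omega>: "?\<Omega> = (\<Pi>\<^sub>E i\<in>UNIV. space (count_space {1::nat..}))"
    by (simp add: code_space_def space_PiM)
  have sets_eq: "sets m = sigma_sets ?\<Omega> ?G"
    unfolding sets_m \<Omega> unfolding code_space_def sets_PiM_single ..
  have "E \<in> sigma_sets ?\<Omega> ?G" using assms(1) sets_eq by simp
  then have "\<forall>e>0. \<exists>r V. window_determined r V \<and> prob (V - E) + prob (E - V) < e"
  proof induction
    case (Basic E)
    then obtain i A where E: "E = {f\<in>?\<Omega>. f i \<in> A}" unfolding \<Omega> by auto
    \<comment> \<open>The \<open>+ 1\<close> is due to the half-open window: coordinate
      \<open>i\<close> itself must lie strictly below the radius.\<close>
    have "window_determined (nat \<bar>i\<bar> + 1) E"
    proof (rule window_determinedI)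
      fix \<tau> \<tau>' assume "\<tau> \<in> E" "\<tau>' \<in> ?\<Omega>" and eq: "\<And>j. - int (nat \<bar>i\<bar> + 1) \<le> j \<Longrightarrow> j < int (nat \<bar>i\<bar> + 1) \<Longrightarrow> \<tau> j = \<tau>' j"
      moreover have "\<tau> i = \<tau>' i" by (rule eq) auto
      ultimately show "\<tau>' \<in> E" by (simp add: E)
    qed (auto simp: E)
    then show ?case by (intro allI impI exI[of _ "nat \<bar>i\<bar> + 1"] exI[of _ E]) simp
  next
    case Empty
    have "window_determined 0 {}" by (simp add: window_determined_def)
    then show ?case by (intro allI impI exI[of _ 0] exI[of _ "{}"]) simp
  next
    case (Compl E)
    have E: "E \<subseteq> ?\<Omega>" using Compl.hyps sets.sets_into_space[of E m] sets_eq space_m by auto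
    show ?case
    proof (intro allI impI)
      fix e :: real assume "e > 0"
      then obtain r V where V: "window_determined r V" "prob (V - E) + prob (E - V) < e" using Compl.IH by blast
      have "(?\<Omega> - V) - (?\<Omega> - E) = E - V" "(?\<Omega> - E) - (?\<Omega> - V) = V - E"
        using E V(1) by (auto simp: window_determined_def)
      then show "\<exists>r V. window_determined r V \<and> prob (V - (?\<Omega> - E)) + prob ((?\<Omega> - E) - V) < e"
        using V window_determined_Diff[OF V(1)] by (intro exI[of _ r] exI[of _ "?\<Omega> - V"]) simp
    qed
  next
    case (Union a)
    have a: "a i \<in> sets m" for i using Union.hyps sets_eq by simp
    show ?case
    proof (intro allI impI)
      fix e :: real assume e: "e > 0"
      \<comment> \<open>A finite part of the union carries all but \<open>e / 2\<close> of its mass,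
        and approximating that part costs the other \<open>e / 2\<close>.\<close>
      have "(\<lambda>N. prob (\<Union>i<N. a i)) \<longlonglongrightarrow> prob (\<Union>N. \<Union>i<N. a i)"
        using a by (intro finite_Lim_measure_incseq) (auto simp: incseq_def intro: less_le_trans)
      also have "(\<Union>N. \<Union>i<N. a i) = (\<Union>i. a i)" by auto
      finally have "eventually (\<lambda>N. prob (\<Union>i. a i) - e / 2 < prob (\<Union>i<N. a i)) sequentially"
        using e by (intro order_tendstoD(1)) auto
      then obtain N where N: "prob (\<Union>i. a i) - e / 2 < prob (\<Union>i<N. a i)"
        by (auto simp: eventually_sequentially)
      let ?A = "\<Union>i<N. a i" and ?B = "\<Union>i. a i"
      have "\<exists>r V. window_determined r V \<and> prob (V - ?A) + prob (?A - V) < e / 2"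
        by (rule approx_finite_union) (use a Union.IH e in auto)
      then obtain r V where V: "window_determined r V" "prob (V - ?A) + prob (?A - V) < e / 2" by blast
      have [measurable]: "V \<in> sets m" "?A \<in> sets m" "?B \<in> sets m"
        using V window_determined_sets a by (auto simp: sets_m)
      have "prob (?B - ?A) = prob ?B - prob ?A" by (rule finite_measure_Diff) auto
      then have d: "prob (?B - ?A) < e / 2" using N by simp
      have "prob (V - ?B) \<le> prob (V - ?A)" by (rule finite_measure_mono) auto
      moreover have "prob (?B - V) \<le> prob ((?A - V) \<union> (?B - ?A))"
        by (rule finite_measure_mono) auto
      moreover have "\<dots> \<le> prob (?A - V) + prob (?B - ?A)"
        by (rule measure_Un_le) measurable
      ultimately show "\<exists>r V. window_determined r V \<and> prob (V - ?B) + prob (?B - V) < e"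
        using V d by (intro exI[of _ r] exI[of _ V]) auto
    qed
  qed
  then show ?thesis using \<open>e > 0\<close> by blast
qed

end

section \<open>Ergodicity and decay of cylinders\<close>

locale quasi_bernoulli = shift_measure +
  fixes K :: real
  assumes K_pos: "K > 0"
    and cylinder_pos: "u \<in> words n \<Longrightarrow> 0 < prob (cylinder 0 u)"
    and cylinder_append_ge:
      "u \<in> words n \<Longrightarrow> v \<in> words n' \<Longrightarrow> prob (cylinder 0 u) * prob (cylinder 0 v) \<le> K * prob (cylinder 0 (u @ v))"
begin

lemma emeasure_UN_cylinder:
  assumes "U \<subseteq> words n"
  shows "emeasure m (\<Union>u\<in>U. cylinder k u) = (\<integral>\<^sup>+u. emeasure m (cylinder 0 u) \<partial>count_space U)"
proof -
  have "emeasure m (\<Union>u\<in>U. cylinder k u) = (\<integral>\<^sup>+u. emeasure m (cylinder k u) \<partial>count_space U)"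
    by (rule emeasure_UN_countable) (use assms in \<open>auto simp: sets_m intro: disjoint_family_cylinder\<close>)
  then show ?thesis by (simp add: emeasure_eq_measure measure_cylinder[of k])
qed

text \<open>Concatenated words occupy adjacent blocks, so \<open>cylinder_append_ge\<close> can be
  summed over all pairs of words. The constant survives because the cylinders of each family are
  disjoint.\<close>

lemma mult_le_Int_shifted_unions:
  assumes U: "U \<subseteq> words n" and V: "V \<subseteq> words n'"
  shows "prob (\<Union>u\<in>U. cylinder 0 u) * prob (\<Union>v\<in>V. cylinder 0 v)
    \<le> K * prob ((\<Union>u\<in>U. cylinder 0 u) \<inter> (\<Union>v\<in>V. cylinder (int n) v))"
proof -
  let ?W = "\<Union>v\<in>V. cylinder (int n) v"
  have Wm: "?W \<in> sets m" unfolding sets_m by (rule sets.countable_UN') auto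
  have le: "emeasure m (cylinder 0 u) * emeasure m (\<Union>v\<in>V. cylinder 0 v) \<le> ennreal K * emeasure m (cylinder 0 u \<inter> ?W)"
    if u: "u \<in> U" for u
  proof -
    have u': "u \<in> words n" "length u = n" using u U by (auto simp: words_def)
    have "emeasure m (cylinder 0 u) * emeasure m (\<Union>v\<in>V. cylinder 0 v)
      = (\<integral>\<^sup>+v. emeasure m (cylinder 0 u) * emeasure m (cylinder 0 v) \<partial>count_space V)"
      by (simp add: emeasure_UN_cylinder[OF V] nn_integral_cmult)
    also have "\<dots> \<le> (\<integral>\<^sup>+v. ennreal K * emeasure m (cylinder 0 (u @ v)) \<partial>count_space V)"
    proof (rule nn_integral_mono)
      fix v assume "v \<in> space (count_space V)"
      then have "v \<in> words n'" using V by auto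
      then show "emeasure m (cylinder 0 u) * emeasure m (cylinder 0 v) \<le> ennreal K * emeasure m (cylinder 0 (u @ v))"
        using cylinder_append_ge[OF u'(1)] K_pos
        by (simp add: emeasure_eq_measure ennreal_mult[symmetric])
    qed
    also have "\<dots> = ennreal K * (\<integral>\<^sup>+v. emeasure m (cylinder 0 (u @ v)) \<partial>count_space V)"
      by (simp add: nn_integral_cmult)
    also have "(\<integral>\<^sup>+v. emeasure m (cylinder 0 (u @ v)) \<partial>count_space V) = emeasure m (\<Union>v\<in>V. cylinder 0 (u @ v))"
    proof (rule emeasure_UN_countable[symmetric])
      show "disjoint_family_on (\<lambda>v. cylinder 0 (u @ v)) V"
        using V by (auto simp: disjoint_family_on_def words_def subset_eq intro!: cylinder_disjoint)
    qed (auto simp: sets_m)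
    also have "(\<Union>v\<in>V. cylinder 0 (u @ v)) = cylinder 0 u \<inter> ?W"
      by (auto simp: cylinder_append u'(2))
    finally show ?thesis .
  qed
  have "emeasure m (\<Union>u\<in>U. cylinder 0 u) * emeasure m (\<Union>v\<in>V. cylinder 0 v)
    = (\<integral>\<^sup>+u. emeasure m (cylinder 0 u) * emeasure m (\<Union>v\<in>V. cylinder 0 v) \<partial>count_space U)"
    by (simp add: emeasure_UN_cylinder[OF U] nn_integral_multc)
  also have "\<dots> \<le> (\<integral>\<^sup>+u. ennreal K * emeasure m (cylinder 0 u \<inter> ?W) \<partial>count_space U)"
    by (rule nn_integral_mono) (use le in auto)
  also have "\<dots> = ennreal K * (\<integral>\<^sup>+u. emeasure m (cylinder 0 u \<inter> ?W) \<partial>count_space U)"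
    by (simp add: nn_integral_cmult)
  also have "(\<integral>\<^sup>+u. emeasure m (cylinder 0 u \<inter> ?W) \<partial>count_space U) = emeasure m (\<Union>u\<in>U. cylinder 0 u \<inter> ?W)"
  proof (rule emeasure_UN_countable[symmetric])
    show "disjoint_family_on (\<lambda>u. cylinder 0 u \<inter> ?W) U"
      using disjoint_family_cylinder[OF U, of 0] by (auto simp: disjoint_family_on_def)
    show "cylinder 0 u \<inter> ?W \<in> sets m" for u using Wm by (auto simp: sets_m)
  qed auto
  also have "(\<Union>u\<in>U. cylinder 0 u \<inter> ?W) = (\<Union>u\<in>U. cylinder 0 u) \<inter> ?W" by blast
  finally show ?thesis
    using K_pos by (simp add: emeasure_eq_measure ennreal_mult[symmetric])
qed

text \<open>Pulling everything back by the shift of order \<open>r\<close> moves the window of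
  \<open>V\<close> to the positions from 0 to \<open>2 * r - 1\<close>; the extra
  \<open>2 * r\<close> puts the window of \<open>W\<close> right behind it.\<close>

lemma mult_le_Int_shift:
  assumes V: "window_determined r V" and W: "window_determined r W"
  shows "prob V * prob W \<le> K * prob (V \<inter> ((left_shift ^^ (2 * r)) -` W \<inter> space m))"
proof -
  define U1 where "U1 = {u \<in> words (2 * r). cylinder (- int r) u \<subseteq> V}"
  define U2 where "U2 = {u \<in> words (2 * r). cylinder (- int r) u \<subseteq> W}"
  have eq: "V = (\<Union>u\<in>U1. cylinder (- int r) u)" "W = (\<Union>u\<in>U2. cylinder (- int r) u)"
    unfolding U1_def U2_def using window_determined_eq_cylinders V W by blast+
  have U: "U1 \<subseteq> words (2 * r)" "U2 \<subseteq> words (2 * r)" by (auto simp: U1_def U2_def)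
  have sh: "(left_shift ^^ n) -` (\<Union>u\<in>U. cylinder k u) \<inter> space m = (\<Union>u\<in>U. cylinder (k + int n) u)" for n k U
    using shift_vimage_cylinder[of n k] unfolding space_m by blast
  have Wm: "V \<in> sets m" "W \<in> sets m" using V W window_determined_sets sets_m by auto
  let ?I = "V \<inter> ((left_shift ^^ (2 * r)) -` W \<inter> space m)"
  have Im: "?I \<in> sets m" using Wm measurable_sets[OF shift_funpow_measurable Wm(2)] by blast
  have V': "(left_shift ^^ r) -` V \<inter> space m = (\<Union>u\<in>U1. cylinder 0 u)"
    "(left_shift ^^ r) -` W \<inter> space m = (\<Union>u\<in>U2. cylinder 0 u)"
    unfolding eq sh by simp_all
  have W': "(left_shift ^^ r) -` ((left_shift ^^ (2 * r)) -` W \<inter> space m) \<inter> space m = (\<Union>u\<in>U2. cylinder (int (2 * r)) u)"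
    unfolding eq sh by (simp add: algebra_simps)
  have I': "(left_shift ^^ r) -` ?I \<inter> space m = (\<Union>u\<in>U1. cylinder 0 u) \<inter> (\<Union>u\<in>U2. cylinder (int (2 * r)) u)"
    unfolding V'[symmetric] W'[symmetric] by blast
  show ?thesis
    using mult_le_Int_shifted_unions[OF U] unfolding I'[symmetric]
    unfolding V'[symmetric] measure_shift_vimage[OF Im] measure_shift_vimage[OF Wm(1)] measure_shift_vimage[OF Wm(2)] .
qed

theorem ergodic:
  assumes E: "E \<in> sets m" and inv: "left_shift -` E \<inter> space m = E"
  shows "prob E = 0 \<or> prob E = 1"
proof -
  have step: "left_shift \<tau> \<in> E \<longleftrightarrow> \<tau> \<in> E" if "\<tau> \<in> space m" for \<tau>
    using inv that by blast
  have invn: "(left_shift ^^ n) \<tau> \<in> E \<longleftrightarrow> \<tau> \<in> E" if "\<tau> \<in> space m" for n \<tau>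
  proof (induction n)
    case (Suc n)
    then show ?case using step[OF measurable_space[OF shift_funpow_measurable that, of n]] by simp
  qed simp
  have bound: "prob E * (1 - prob E) \<le> e" if "e > 0" for e
  proof -
    \<comment> \<open>The final estimate is \<open>K * d\<close> from the product inequality plus
      \<open>d\<close> for replacing \<open>E\<close> by \<open>V\<close>.\<close>
    define d where "d = e / (K + 1)"
    have d: "d > 0" using that K_pos by (simp add: d_def)
    obtain r V where V: "window_determined r V" "prob (V - E) + prob (E - V) < d"
      using approx_window_determined[OF E d] by blast
    let ?W = "space code_space - V"
    have [measurable]: "V \<in> sets m" "E \<in> sets m" using V window_determined_sets sets_m E by auto
    have EV: "E - V \<in> sets m" by measurable
    have PE: "(left_shift ^^ (2 * r)) -` (E - V) \<inter> space m \<in> sets m"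
      by (rule measurable_sets[OF shift_funpow_measurable EV])
    \<comment> \<open>A point of \<open>V\<close> outside \<open>E\<close> is in the first set. A
      point of \<open>E\<close> stays in \<open>E\<close> under the shift, so if its image misses
      \<open>V\<close>, that image lies in \<open>E - V\<close>.\<close>
    have "prob (V \<inter> ((left_shift ^^ (2 * r)) -` ?W \<inter> space m))
      \<le> prob ((V - E) \<union> ((left_shift ^^ (2 * r)) -` (E - V) \<inter> space m))"
      by (rule finite_measure_mono) (use invn PE in auto)
    also have "\<dots> \<le> prob (V - E) + prob ((left_shift ^^ (2 * r)) -` (E - V) \<inter> space m)"
      by (rule measure_Un_le) (use PE in auto)
    also have "\<dots> < d" using V(2) measure_shift_vimage[OF EV] by simp
    finally have "K * prob (V \<inter> ((left_shift ^^ (2 * r)) -` ?W \<inter> space m)) \<le> K * d"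
      using K_pos by simp
    then have VV: "prob V * prob ?W \<le> K * d"
      using mult_le_Int_shift[OF V(1) window_determined_Diff[OF V(1)]] by linarith
    have pW: "prob ?W = 1 - prob V" using prob_compl[of V] by (simp add: space_m)
    have "\<bar>prob E - prob V\<bar> \<le> d"
    proof -
      have "prob (E - V) = prob E - prob (E \<inter> V)" "prob (V - E) = prob V - prob (V \<inter> E)"
        by (rule finite_measure_Diff'; simp)+
      moreover have "V \<inter> E = E \<inter> V" by blast
      moreover have "prob (E - V) \<ge> 0" "prob (V - E) \<ge> 0" by auto
      ultimately show ?thesis using V(2) by (simp add: abs_le_iff)
    qed
    moreover have "\<bar>1 - prob E - prob V\<bar> \<le> 1"
      using prob_le_1[of E] prob_le_1[of V] measure_nonneg[of m E] measure_nonneg[of m V] by linarith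
    ultimately have "\<bar>prob E - prob V\<bar> * \<bar>1 - prob E - prob V\<bar> \<le> d * 1"
      using d by (intro mult_mono) auto
    then have "\<bar>(prob E - prob V) * (1 - prob E - prob V)\<bar> \<le> d" by (simp add: abs_mult)
    \<comment> \<open>The difference of \<open>t * (1 - t)\<close> at two points factors as shown;
      the second factor is at most 1 in absolute value on the unit interval.\<close>
    moreover have "prob E * (1 - prob E) = prob V * (1 - prob V) + (prob E - prob V) * (1 - prob E - prob V)"
      by (simp add: algebra_simps)
    ultimately have "prob E * (1 - prob E) \<le> K * d + d" using VV pW by simp
    also have "\<dots> = (K + 1) * d" by (simp add: algebra_simps)
    also have "\<dots> = e" using K_pos by (simp add: d_def)
    finally show ?thesis .
  qed
  have "prob E * (1 - prob E) \<le> 0" by (rule field_le_epsilon) (use bound in simp)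
  moreover have "prob E * (1 - prob E) \<ge> 0" by simp
  ultimately show ?thesis by auto
qed

text \<open>Extending a word by one digit excludes its extension by a competing digit, and by the
  quasi-Bernoulli inequality the competitor takes a fixed proportion of the cylinder.\<close>

lemma cylinder_decay: "\<exists>\<rho>\<ge>0. \<rho> < 1 \<and> (\<forall>n. \<forall>u\<in>words n. prob (cylinder 0 u) \<le> \<rho> ^ n)"
proof -
  \<comment> \<open>Two competitors are enough: one of 1 and 2 differs from any given digit, so the
    bound is uniform over the infinite alphabet.\<close>
  let ?q = "min (prob (cylinder 0 [1])) (prob (cylinder 0 [2]))"
  have w1: "[1::nat] \<in> words 1" "[2::nat] \<in> words 1" by (auto simp: words_def)
  have q: "?q > 0" using cylinder_pos w1 by simp
  \<comment> \<open>The maximum with 0 makes nonnegativity immediate, without a comparison of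
    \<open>?q\<close> and \<open>K\<close>.\<close>
  define \<rho> where "\<rho> = max 0 (1 - ?q / K)"
  have \<rho>: "\<rho> \<ge> 0" "\<rho> < 1" using q K_pos by (auto simp: \<rho>_def)
  have step: "prob (cylinder 0 (u @ [a])) \<le> \<rho> * prob (cylinder 0 u)" if u: "u \<in> words n" for u n a
  proof -
    define b :: nat where "b = (if a = 1 then 2 else 1)"
    have b: "b \<noteq> a" "b = 1 \<or> b = 2" by (auto simp: b_def)
    have bw: "[b] \<in> words 1" "?q \<le> prob (cylinder 0 [b])" using b w1 by auto
    have dj: "cylinder 0 (u @ [a]) \<inter> cylinder 0 (u @ [b]) = {}" using b by (intro cylinder_disjoint) auto
    have "prob (cylinder 0 (u @ [a])) + prob (cylinder 0 (u @ [b])) = prob (cylinder 0 (u @ [a]) \<union> cylinder 0 (u @ [b]))"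
      by (rule finite_measure_Union[symmetric]) (use dj in \<open>auto simp: sets_m\<close>)
    also have "\<dots> \<le> prob (cylinder 0 u)"
      by (rule finite_measure_mono) (auto simp: cylinder_append sets_m)
    finally have 1: "prob (cylinder 0 (u @ [a])) + prob (cylinder 0 (u @ [b])) \<le> prob (cylinder 0 u)" .
    have "prob (cylinder 0 u) * ?q \<le> prob (cylinder 0 u) * prob (cylinder 0 [b])"
      using bw(2) by (rule mult_left_mono) simp
    also have "\<dots> \<le> K * prob (cylinder 0 (u @ [b]))" by (rule cylinder_append_ge[OF u bw(1)])
    finally have "prob (cylinder 0 u) * (?q / K) \<le> prob (cylinder 0 (u @ [b]))"
      using K_pos by (simp add: field_simps)
    then have "prob (cylinder 0 (u @ [a])) \<le> (1 - ?q / K) * prob (cylinder 0 u)"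
      using 1 by (simp add: algebra_simps)
    also have "\<dots> \<le> \<rho> * prob (cylinder 0 u)" by (rule mult_right_mono) (auto simp: \<rho>_def)
    finally show ?thesis .
  qed
  have "prob (cylinder 0 u) \<le> \<rho> ^ n" if "u \<in> words n" for u n
    using that
  proof (induction u arbitrary: n rule: rev_induct)
    case Nil
    then show ?case by (auto simp: words_def)
  next
    case (snoc a u)
    then have u: "u \<in> words (n - 1)" "n = Suc (n - 1)" by (auto simp: words_def)
    have "prob (cylinder 0 (u @ [a])) \<le> \<rho> * prob (cylinder 0 u)" by (rule step[OF u(1)])
    also have "\<dots> \<le> \<rho> * \<rho> ^ (n - 1)" using snoc.IH[OF u(1)] \<rho> by (intro mult_left_mono)
    also have "\<dots> = \<rho> ^ n" using u(2) by (metis power_Suc)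
    finally show ?case .
  qed
  then show ?thesis using \<rho> by blast
qed

text \<open>The position \<open>k\<close> may vary with \<open>n\<close>, because a set that fixes
  the past lies in cylinders starting further and further to the left.\<close>

lemma subset_cylinders_null:
  assumes A: "A \<in> sets m" and sub: "\<And>n. \<exists>k. \<exists>u\<in>words n. A \<subseteq> cylinder k u"
  shows "prob A = 0"
proof -
  obtain \<rho> where \<rho>: "\<rho> \<ge> 0" "\<rho> < 1" "\<And>n u. u \<in> words n \<Longrightarrow> prob (cylinder 0 u) \<le> \<rho> ^ n"
    using cylinder_decay by blast
  have "prob A \<le> \<rho> ^ n" for n
  proof -
    obtain k u where u: "u \<in> words n" "A \<subseteq> cylinder k u" using sub by blast
    have "prob A \<le> prob (cylinder k u)" by (rule finite_measure_mono) (use u in \<open>auto simp: sets_m\<close>)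
    then show ?thesis using \<rho>(3)[OF u(1)] measure_cylinder[of k u] by linarith
  qed
  moreover have "(\<lambda>n. \<rho> ^ n) \<longlonglongrightarrow> 0" using \<rho> by (intro LIMSEQ_realpow_zero)
  ultimately have "prob A \<le> 0" by (intro LIMSEQ_le_const) auto
  then show ?thesis by (simp add: measure_le_0_iff)
qed

end

text \<open>A cylinder has one measure, so the Gibbs bounds at any two of its points force their Birkhoff
  sums to agree up to a constant; this replaces a distortion estimate for the potential.\<close>

lemma gibbs_state_quasi_bernoulli:
  assumes "gibbs_state \<phi> m"
  shows "\<exists>K. quasi_bernoulli m K"
proof -
  obtain C P where CP: "C \<ge> 1" and G: "\<And>n \<omega>. n \<ge> 1 \<Longrightarrow> \<omega> \<in> space code_space \<Longrightarrow>
      let r = measure m {\<tau> \<in> space code_space. \<forall>j<n. \<tau> (int j) = \<omega> (int j)} /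
                exp ((\<Sum>j<n. \<phi> ((left_shift ^^ j) \<omega>)) - P * real n)
        in 1 / C \<le> r \<and> r \<le> C"
    using assms unfolding gibbs_state_def by blast
  interpret shift_measure m
    using assms by (auto simp: gibbs_state_def shift_measure_def shift_measure_axioms_def)
  define Z where "Z = (\<lambda>n \<omega>. exp ((\<Sum>j<n. \<phi> ((left_shift ^^ j) \<omega>)) - P * real n))"
  have cyl_eq: "{\<tau> \<in> space code_space. \<forall>j<length u. \<tau> (int j) = \<omega> (int j)} = cylinder 0 u"
    if "\<omega> \<in> cylinder 0 u" for \<omega> u
    using that by (auto simp: cylinder_def)
  have bounds: "Z n \<omega> \<le> C * prob (cylinder 0 u)" "prob (cylinder 0 u) \<le> C * Z n \<omega>"
    if "\<omega> \<in> cylinder 0 u" "length u = n" "n \<ge> 1" for \<omega> u n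
  proof -
    have "\<omega> \<in> space code_space" using that by (simp add: cylinder_def)
    then have "1 / C \<le> prob (cylinder 0 u) / Z n \<omega>" "prob (cylinder 0 u) / Z n \<omega> \<le> C"
      using G[of n \<omega>] cyl_eq[OF that(1)] that by (auto simp: Let_def Z_def)
    moreover have "Z n \<omega> > 0" by (simp add: Z_def)
    ultimately show "Z n \<omega> \<le> C * prob (cylinder 0 u)" "prob (cylinder 0 u) \<le> C * Z n \<omega>"
      using CP by (simp_all add: field_simps)
  qed
  have Zpos: "Z n \<omega> > 0" for n \<omega> by (simp add: Z_def)
  \<comment> \<open>Padding with the digit 1 turns a word into a two-sided sequence of positive
    integers.\<close>
  have ex: "\<exists>\<omega>. \<omega> \<in> cylinder 0 u" if "u \<in> words n" for u n
    using that
    by (intro exI[of _ "\<lambda>i. if 0 \<le> i \<and> i < int (length u) then u ! nat i else 1"])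
       (auto simp: cylinder_def words_def space_code_space)
  have Zadd: "Z (n + n') \<omega> = Z n \<omega> * Z n' ((left_shift ^^ n) \<omega>)" for n n' \<omega>
  proof -
    have "(\<Sum>j<n + n'. \<phi> ((left_shift ^^ j) \<omega>)) = (\<Sum>j<n. \<phi> ((left_shift ^^ j) \<omega>)) + (\<Sum>j<n'. \<phi> ((left_shift ^^ j) ((left_shift ^^ n) \<omega>)))"
      by (induction n') (simp_all add: funpow_add add.commute[of n] del: funpow.simps)
    then show ?thesis unfolding Z_def exp_add[symmetric] by (simp add: algebra_simps)
  qed
  \<comment> \<open>Each of the two upper bounds for the factors costs one \<open>C\<close>, the
    lower bound for the concatenation a third. The Gibbs bounds start at \<open>n = 1\<close>, so
    empty words are treated apart.\<close>
  have "quasi_bernoulli m (C ^ 3)"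
  proof
    show "C ^ 3 > 0" using CP by simp
    show "0 < prob (cylinder 0 u)" if u: "u \<in> words n" for u n
    proof (cases "n = 0")
      case True
      then have "u = []" using u by (simp add: words_def)
      then show ?thesis using prob_space by (simp add: space_m)
    next
      case False
      obtain \<omega> where "\<omega> \<in> cylinder 0 u" using ex[OF u] by blast
      then have "0 < C * prob (cylinder 0 u)"
        using bounds(1)[of \<omega> u n] Zpos[of n \<omega>] u False by (auto simp: words_def)
      then show ?thesis using CP by (simp add: zero_less_mult_iff)
    qed
    show "prob (cylinder 0 u) * prob (cylinder 0 v) \<le> C ^ 3 * prob (cylinder 0 (u @ v))"
      if u: "u \<in> words n" and v: "v \<in> words n'" for u v n n'
    proof (cases "n = 0 \<or> n' = 0")
      case True
      have C3: "1 \<le> C ^ 3" using CP by (rule one_le_power)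
      have p1: "prob (space code_space) = 1" using prob_space by (simp add: space_m)
      have "prob (cylinder 0 u) * prob (cylinder 0 v) = 1 * prob (cylinder 0 (u @ v))"
        using True u v p1 by (auto simp: words_def)
      also have "\<dots> \<le> C ^ 3 * prob (cylinder 0 (u @ v))" using C3 by (rule mult_right_mono) simp
      finally show ?thesis .
    next
      case False
      have uv: "u @ v \<in> words (n + n')" "length u = n" "length v = n'" using u v by (auto simp: words_def)
      obtain \<omega> where \<omega>: "\<omega> \<in> cylinder 0 (u @ v)" using ex[OF uv(1)] by blast
      have \<omega>u: "\<omega> \<in> cylinder 0 u" using \<omega> by (simp add: cylinder_append)
      have "\<omega> \<in> (left_shift ^^ n) -` cylinder 0 v \<inter> space code_space"
        using \<omega> unfolding shift_vimage_cylinder cylinder_append uv(2) by simp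
      then have \<omega>v: "(left_shift ^^ n) \<omega> \<in> cylinder 0 v" by blast
      have "prob (cylinder 0 u) * prob (cylinder 0 v) \<le> (C * Z n \<omega>) * (C * Z n' ((left_shift ^^ n) \<omega>))"
        by (rule mult_mono) (use bounds(2)[OF \<omega>u uv(2)] bounds(2)[OF \<omega>v uv(3)] False Zpos[of n \<omega>] CP in auto)
      also have "\<dots> = C\<^sup>2 * Z (n + n') \<omega>" by (simp add: Zadd power2_eq_square)
      also have "\<dots> \<le> C\<^sup>2 * (C * prob (cylinder 0 (u @ v)))"
        by (rule mult_left_mono) (use bounds(1)[OF \<omega>] uv False in auto)
      finally show ?thesis by (simp add: power3_eq_cube power2_eq_square mult.assoc)
    qed
  qed
  then show ?thesis by blast
qed

section \<open>Equidistribution\<close>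

abbreviation (input) rect :: "real \<Rightarrow> real \<Rightarrow> real \<Rightarrow> real \<Rightarrow> (real \<times> real) set" where
  "rect a b c d \<equiv> {a<..<b} \<times> {c<..<d}"

text \<open>Written as a Birkhoff average of an indicator, to fit the ergodic theorem;
  \<open>frequency_eq_card\<close> returns to counting.\<close>

definition frequency :: "'a set \<Rightarrow> (nat \<Rightarrow> 'a) \<Rightarrow> nat \<Rightarrow> real" where
  "frequency A p n = (\<Sum>k<n. indicator A (p k)) / real n"

lemma frequency_eq_card: "frequency A p n = real (card {k \<in> {0..<n}. p k \<in> A}) / real n"
proof -
  have "(\<Sum>k<n. indicator A (p k) :: real) = (\<Sum>k\<in>{k \<in> {0..<n}. p k \<in> A}. 1)"
    unfolding lessThan_atLeast0 by (rule sum.mono_neutral_cong_right) (auto simp: indicator_def)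
  then show ?thesis by (simp add: frequency_def)
qed

text \<open>The first \<open>N\<close> indices, about which nothing is assumed, contribute at most
  \<open>N / n\<close>, which vanishes in the limit.\<close>

lemma frequency_le:
  assumes "\<And>k. k \<ge> N \<Longrightarrow> p k \<in> A \<Longrightarrow> q k \<in> B"
  shows "frequency A p n \<le> real N / real n + frequency B q n"
proof -
  have "{k \<in> {0..<n}. p k \<in> A} \<subseteq> {..<N} \<union> {k \<in> {0..<n}. q k \<in> B}"
    using assms by (auto simp: not_less)
  then have "card {k \<in> {0..<n}. p k \<in> A} \<le> card ({..<N} \<union> {k \<in> {0..<n}. q k \<in> B})"
    by (intro card_mono) auto
  also have "\<dots> \<le> N + card {k \<in> {0..<n}. q k \<in> B}"
    using card_Un_le[of "{..<N}" "{k \<in> {0..<n}. q k \<in> B}"] by simp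
  finally have "real (card {k \<in> {0..<n}. p k \<in> A}) / real n \<le> real (N + card {k \<in> {0..<n}. q k \<in> B}) / real n"
    by (intro divide_right_mono) auto
  then show ?thesis by (simp add: frequency_eq_card add_divide_distrib)
qed

text \<open>An open rectangle is the increasing union of shrunken copies, so continuity from below
  applies. The rational sides are strictly inside, which leaves room for a perturbation.\<close>

lemma inner_rational_rect:
  assumes "finite_measure \<nu>" "sets \<nu> = sets borel" "y < measure \<nu> (rect a b c d)"
  obtains a' b' c' d' :: rat where "a < of_rat a'" "of_rat b' < b" "c < of_rat c'" "of_rat d' < d"
    "y < measure \<nu> (rect (of_rat a') (of_rat b') (of_rat c') (of_rat d'))"
proof -
  interpret finite_measure \<nu> by fact
  have [measurable]: "rect a b c d \<in> sets \<nu>" for a b c d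
    unfolding assms(2) borel_prod[symmetric] by simp
  define e where "e = (\<lambda>j. 1 / real (Suc j))"
  have e_pos: "e j > 0" for j by (simp add: e_def)
  have e_small: "\<exists>j. e j < r" if "r > 0" for r using nat_approx_posE[OF that] unfolding e_def by metis
  let ?I = "\<lambda>j. rect (a + e j) (b - e j) (c + e j) (d - e j)"
  have e_mono: "e j \<le> e i" if "i \<le> j" for i j using that by (simp add: e_def frac_le)
  have "(\<lambda>j. measure \<nu> (?I j)) \<longlonglongrightarrow> measure \<nu> (\<Union>j. ?I j)"
  proof (rule finite_Lim_measure_incseq)
    show "incseq ?I"
    proof (rule incseq_SucI)
      fix j
      have "e (Suc j) \<le> e j" by (rule e_mono) simp
      then show "?I j \<subseteq> ?I (Suc j)" by auto
    qed
  qed auto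
  also have "(\<Union>j. ?I j) = rect a b c d"
  proof (intro equalityI subsetI)
    fix q assume q: "q \<in> rect a b c d"
    define \<delta> where "\<delta> = Min {fst q - a, b - fst q, snd q - c, d - snd q}"
    have "\<delta> > 0" using q by (auto simp: \<delta>_def)
    then obtain j where "e j < \<delta>" using e_small by blast
    then have "q \<in> ?I j" by (cases q) (auto simp: \<delta>_def)
    then show "q \<in> (\<Union>j. ?I j)" by blast
  next
    fix q assume "q \<in> (\<Union>j. ?I j)"
    then obtain j where "q \<in> ?I j" by blast
    then show "q \<in> rect a b c d" using e_pos[of j] by (cases q) simp
  qed
  finally have "eventually (\<lambda>j. y < measure \<nu> (?I j)) sequentially"
    using assms(3) by (rule order_tendstoD(1))
  then obtain j where j: "y < measure \<nu> (?I j)" by (auto simp: eventually_sequentially)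
  note e_pos[of j]
  then have "\<exists>a'. a < of_rat a' \<and> of_rat a' < a + e j" "\<exists>b'. b - e j < of_rat b' \<and> of_rat b' < b"
    "\<exists>c'. c < of_rat c' \<and> of_rat c' < c + e j" "\<exists>d'. d - e j < of_rat d' \<and> of_rat d' < d"
    by (intro of_rat_dense; linarith)+
  then obtain a' b' c' d' :: rat where *: "a < of_rat a'" "of_rat a' < a + e j" "b - e j < of_rat b'" "of_rat b' < b"
    "c < of_rat c'" "of_rat c' < c + e j" "d - e j < of_rat d'" "of_rat d' < d" by blast
  have "measure \<nu> (?I j) \<le> measure \<nu> (rect (of_rat a') (of_rat b') (of_rat c') (of_rat d'))"
    by (rule finite_measure_mono) (use * in auto)
  then show ?thesis using that[of a' b' c' d'] * j by linarith
qed

text \<open>Enlarged rectangles decrease to the closed one, which exceeds the open one only by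
  points on four lines; \<open>null\<close> rules out a jump of the measure there.\<close>

lemma outer_rational_rect:
  assumes "finite_measure \<nu>" "sets \<nu> = sets borel" "measure \<nu> (rect a b c d) < y"
    and null: "\<And>t. measure \<nu> ({t} \<times> UNIV) = 0" "\<And>t. measure \<nu> (UNIV \<times> {t}) = 0"
  obtains a' b' c' d' :: rat where "of_rat a' < a" "b < of_rat b'" "of_rat c' < c" "d < of_rat d'"
    "measure \<nu> (rect (of_rat a') (of_rat b') (of_rat c') (of_rat d')) < y"
proof -
  interpret finite_measure \<nu> by fact
  have [measurable]: "rect a b c d \<in> sets \<nu>" for a b c d
    unfolding assms(2) borel_prod[symmetric] by simp
  have [measurable]: "{t} \<times> UNIV \<in> sets \<nu>" "UNIV \<times> {t} \<in> sets \<nu>" for t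
    unfolding assms(2) borel_prod[symmetric] by (rule pair_measureI; simp)+
  define e where "e = (\<lambda>j. 1 / real (Suc j))"
  have e_pos: "e j > 0" for j by (simp add: e_def)
  have e_small: "\<exists>j. e j < r" if "r > 0" for r using nat_approx_posE[OF that] unfolding e_def by metis
  let ?O = "\<lambda>j. rect (a - e j) (b + e j) (c - e j) (d + e j)"
  have e_mono: "e j \<le> e i" if "i \<le> j" for i j using that by (simp add: e_def frac_le)
  have "(\<lambda>j. measure \<nu> (?O j)) \<longlonglongrightarrow> measure \<nu> (\<Inter>j. ?O j)"
  proof (rule finite_Lim_measure_decseq)
    show "decseq ?O"
    proof (rule decseq_SucI)
      fix j
      have "e (Suc j) \<le> e j" by (rule e_mono) simp
      then show "?O (Suc j) \<subseteq> ?O j" by auto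
    qed
  qed auto
  moreover have "measure \<nu> (\<Inter>j. ?O j) < y"
  proof -
    let ?L = "({a} \<times> UNIV \<union> {b} \<times> UNIV) \<union> (UNIV \<times> {c} \<union> UNIV \<times> {d})"
    have "(\<Inter>j. ?O j) \<subseteq> rect a b c d \<union> ?L"
    proof
      fix q assume q: "q \<in> (\<Inter>j. ?O j)"
      have le: "u \<le> v" if "\<And>j. u < v + e j" for u v :: real
      proof (rule field_le_epsilon)
        fix r :: real assume "r > 0"
        then obtain j where "e j < r" using e_small by blast
        then show "u \<le> v + r" using that[of j] by linarith
      qed
      have "a - e j < fst q \<and> fst q < b + e j \<and> c - e j < snd q \<and> snd q < d + e j" for j
        using q by (cases q) auto
      note q' = this
      have "a \<le> fst q" "fst q \<le> b" "c \<le> snd q" "snd q \<le> d"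
        by (rule le, use q' in \<open>simp add: less_diff_eq diff_less_eq\<close>)+
      then show "q \<in> rect a b c d \<union> ?L" by (cases q) auto
    qed
    then have "measure \<nu> (\<Inter>j. ?O j) \<le> measure \<nu> (rect a b c d \<union> ?L)"
      by (rule finite_measure_mono) measurable
    also have "\<dots> \<le> measure \<nu> (rect a b c d) + measure \<nu> ?L"
      by (rule measure_Un_le) measurable
    also have "measure \<nu> ?L \<le> measure \<nu> ({a} \<times> UNIV \<union> {b} \<times> UNIV) + measure \<nu> (UNIV \<times> {c} \<union> UNIV \<times> {d})"
      by (rule measure_Un_le) measurable
    also have "measure \<nu> ({a} \<times> UNIV \<union> {b} \<times> UNIV) \<le> measure \<nu> ({a} \<times> UNIV) + measure \<nu> ({b} \<times> UNIV)"
      by (rule measure_Un_le) measurable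
    also have "measure \<nu> (UNIV \<times> {c} \<union> UNIV \<times> {d}) \<le> measure \<nu> (UNIV \<times> {c}) + measure \<nu> (UNIV \<times> {d})"
      by (rule measure_Un_le) measurable
    finally show ?thesis using null assms(3) by simp
  qed
  ultimately have "eventually (\<lambda>j. measure \<nu> (?O j) < y) sequentially"
    by (rule order_tendstoD(2))
  then obtain j where j: "measure \<nu> (?O j) < y" by (auto simp: eventually_sequentially)
  note e_pos[of j]
  then have "\<exists>a'. a - e j < of_rat a' \<and> of_rat a' < a" "\<exists>b'. b < of_rat b' \<and> of_rat b' < b + e j"
    "\<exists>c'. c - e j < of_rat c' \<and> of_rat c' < c" "\<exists>d'. d < of_rat d' \<and> of_rat d' < d + e j"
    by (intro of_rat_dense; linarith)+
  then obtain a' b' c' d' :: rat where *: "a - e j < of_rat a'" "of_rat a' < a" "b < of_rat b'" "of_rat b' < b + e j"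
    "c - e j < of_rat c'" "of_rat c' < c" "d < of_rat d'" "of_rat d' < d + e j" by blast
  have "measure \<nu> (rect (of_rat a') (of_rat b') (of_rat c') (of_rat d')) \<le> measure \<nu> (?O j)"
    by (rule finite_measure_mono) (use * in auto)
  then show ?thesis using that[of a' b' c' d'] * j by linarith
qed

lemma eventually_coordinates_close:
  fixes p q :: "nat \<Rightarrow> real \<times> real"
  assumes "(\<lambda>k. dist (p k) (q k)) \<longlonglongrightarrow> 0" "\<delta> > 0"
  shows "\<exists>N. \<forall>k\<ge>N. \<bar>fst (p k) - fst (q k)\<bar> < \<delta> \<and> \<bar>snd (p k) - snd (q k)\<bar> < \<delta>"
proof -
  obtain N where N: "\<And>k. k \<ge> N \<Longrightarrow> dist (p k) (q k) < \<delta>"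
    using order_tendstoD(2)[OF assms] by (auto simp: eventually_sequentially)
  show ?thesis
    using N dist_fst_le[of "p _" "q _"] dist_snd_le[of "p _" "q _"]
    by (intro exI[of _ N]) (metis dist_real_def le_less_trans)
qed

text \<open>Inner rational rectangles give the lower bound and outer ones the upper bound. The gap
  \<delta> between the sides absorbs the distance of \<open>z\<close> and \<open>p\<close> from some
  index on, so the perturbation and the passage to real sides are handled together.\<close>

lemma frequency_LIMSEQ_rect:
  fixes z p :: "nat \<Rightarrow> real \<times> real"
  assumes \<nu>: "finite_measure \<nu>" "sets \<nu> = sets borel"
    and null: "\<And>t. measure \<nu> ({t} \<times> UNIV) = 0" "\<And>t. measure \<nu> (UNIV \<times> {t}) = 0"
    and rat: "\<And>a b c d :: rat. frequency (rect (of_rat a) (of_rat b) (of_rat c) (of_rat d)) z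
      \<longlonglongrightarrow> measure \<nu> (rect (of_rat a) (of_rat b) (of_rat c) (of_rat d))"
    and close: "(\<lambda>k. dist (z k) (p k)) \<longlonglongrightarrow> 0"
  shows "frequency (rect a b c d) p \<longlonglongrightarrow> measure \<nu> (rect a b c d)"
proof (rule order_tendstoI)
  fix y assume "y < measure \<nu> (rect a b c d)"
  then obtain a' b' c' d' :: rat where *: "a < of_rat a'" "of_rat b' < b" "c < of_rat c'" "of_rat d' < d"
    and y: "y < measure \<nu> (rect (of_rat a') (of_rat b') (of_rat c') (of_rat d'))"
    using inner_rational_rect[OF \<nu>] by metis
  let ?R = "rect (of_rat a') (of_rat b') (of_rat c') (of_rat d')"
  define \<delta> where "\<delta> = Min {of_rat a' - a, b - of_rat b', of_rat c' - c, d - of_rat d'}"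
  have "\<delta> > 0" using * by (auto simp: \<delta>_def)
  then obtain N where N: "\<forall>k\<ge>N. \<bar>fst (z k) - fst (p k)\<bar> < \<delta> \<and> \<bar>snd (z k) - snd (p k)\<bar> < \<delta>"
    using eventually_coordinates_close[OF close] by blast
  have le: "frequency ?R z n \<le> real N / real n + frequency (rect a b c d) p n" for n
  proof (rule frequency_le)
    fix k assume "k \<ge> N" "z k \<in> ?R"
    then show "p k \<in> rect a b c d"
      using N[rule_format, of k] by (cases "p k"; cases "z k") (auto simp: \<delta>_def)
  qed
  have "(\<lambda>n. frequency ?R z n - real N / real n) \<longlonglongrightarrow> measure \<nu> ?R - 0"
    by (intro tendsto_diff rat lim_const_over_n)
  then have "eventually (\<lambda>n. y < frequency ?R z n - real N / real n) sequentially"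
    using y by (intro order_tendstoD(1)) auto
  then show "eventually (\<lambda>n. y < frequency (rect a b c d) p n) sequentially"
    by eventually_elim (use le in \<open>smt (verit)\<close>)
next
  fix y assume "measure \<nu> (rect a b c d) < y"
  then obtain a' b' c' d' :: rat where *: "of_rat a' < a" "b < of_rat b'" "of_rat c' < c" "d < of_rat d'"
    and y: "measure \<nu> (rect (of_rat a') (of_rat b') (of_rat c') (of_rat d')) < y"
    using outer_rational_rect[OF \<nu> _ null] by metis
  let ?R = "rect (of_rat a') (of_rat b') (of_rat c') (of_rat d')"
  define \<delta> where "\<delta> = Min {a - of_rat a', of_rat b' - b, c - of_rat c', of_rat d' - d}"
  have "\<delta> > 0" using * by (auto simp: \<delta>_def)
  then obtain N where N: "\<forall>k\<ge>N. \<bar>fst (z k) - fst (p k)\<bar> < \<delta> \<and> \<bar>snd (z k) - snd (p k)\<bar> < \<delta>"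
    using eventually_coordinates_close[OF close] by blast
  have le: "frequency (rect a b c d) p n \<le> real N / real n + frequency ?R z n" for n
  proof (rule frequency_le)
    fix k assume "k \<ge> N" "p k \<in> rect a b c d"
    then show "z k \<in> ?R"
      using N[rule_format, of k] by (cases "p k"; cases "z k") (auto simp: \<delta>_def)
  qed
  have "(\<lambda>n. real N / real n + frequency ?R z n) \<longlonglongrightarrow> 0 + measure \<nu> ?R"
    by (intro tendsto_add rat lim_const_over_n)
  then have "eventually (\<lambda>n. real N / real n + frequency ?R z n < y) sequentially"
    using y by (intro order_tendstoD(2)) auto
  then show "eventually (\<lambda>n. frequency (rect a b c d) p n < y) sequentially"
    by eventually_elim (use le in \<open>smt (verit)\<close>)
qed

text \<open>The tolerances \<open>1 / real (Suc j)\<close> reduce convergence to countable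
  quantifiers over measurable conditions.\<close>

lemma pred_LIMSEQ:
  fixes F :: "nat \<Rightarrow> 'a \<Rightarrow> real"
  assumes [measurable]: "\<And>n. F n \<in> borel_measurable M"
  shows "Measurable.pred M (\<lambda>x. (\<lambda>n. F n x) \<longlonglongrightarrow> L)"
proof -
  have "(\<lambda>n. F n x) \<longlonglongrightarrow> L \<longleftrightarrow> (\<forall>j. \<exists>N. \<forall>n. n \<ge> N \<longrightarrow> \<bar>F n x - L\<bar> < 1 / real (Suc j))" for x
  proof
    assume "(\<lambda>n. F n x) \<longlonglongrightarrow> L"
    then show "\<forall>j. \<exists>N. \<forall>n. n \<ge> N \<longrightarrow> \<bar>F n x - L\<bar> < 1 / real (Suc j)"
      unfolding LIMSEQ_iff by simp
  next
    assume *: "\<forall>j. \<exists>N. \<forall>n. n \<ge> N \<longrightarrow> \<bar>F n x - L\<bar> < 1 / real (Suc j)"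
    show "(\<lambda>n. F n x) \<longlonglongrightarrow> L"
      unfolding LIMSEQ_iff real_norm_def
    proof (intro allI impI)
      fix r :: real assume "r > 0"
      then obtain j where "1 / real (Suc j) < r" using nat_approx_posE by blast
      then show "\<exists>no. \<forall>n\<ge>no. \<bar>F n x - L\<bar> < r" using * by (meson less_trans)
    qed
  qed
  then show ?thesis by simp
qed

section \<open>Transfer from two-sided sequences to continued fractions\<close>

lemma cf_code_measurable: "cf_code \<in> measurable code_space borel"
  unfolding cf_code_def[abs_def] by (intro borel_measurable_Pair cf_inf_measurable) measurable

lemma cf_code_future_inj:
  assumes "\<tau> \<in> space code_space" "\<tau>' \<in> space code_space" "fst (cf_code \<tau>) = fst (cf_code \<tau>')"
  shows "\<tau> (int i) = \<tau>' (int i)"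
proof -
  have "gauss_digit (fst (cf_code \<sigma>)) = (\<lambda>i. \<sigma> (int i))" if "\<sigma> \<in> space code_space" for \<sigma>
    unfolding cf_code_def fst_conv by (rule gauss_digit_cf_inf) (use that in \<open>simp add: space_code_space\<close>)
  then show ?thesis using assms by metis
qed

lemma cf_code_past_inj:
  assumes "\<tau> \<in> space code_space" "\<tau>' \<in> space code_space" "snd (cf_code \<tau>) = snd (cf_code \<tau>')"
  shows "\<tau> (- 1 - int i) = \<tau>' (- 1 - int i)"
proof -
  have "gauss_digit (snd (cf_code \<sigma>)) = (\<lambda>i. \<sigma> (- 1 - int i))" if "\<sigma> \<in> space code_space" for \<sigma>
    unfolding cf_code_def snd_conv by (rule gauss_digit_cf_inf) (use that in \<open>simp add: space_code_space\<close>)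
  then show ?thesis using assms by metis
qed

context quasi_bernoulli
begin

lemma cf_code_measurable_m: "cf_code \<in> measurable m borel"
  unfolding measurable_m by (rule cf_code_measurable)

lemma sets_mu_hat: "sets (mu_hat m) = sets borel"
  by (simp add: mu_hat_def)

lemma finite_measure_mu_hat: "finite_measure (mu_hat m)"
  unfolding mu_hat_def by (rule finite_measure_distr[OF cf_code_measurable_m])

lemma measure_mu_hat: "A \<in> sets borel \<Longrightarrow> measure (mu_hat m) A = prob (cf_code -` A \<inter> space m)"
  unfolding mu_hat_def by (rule measure_distr[OF cf_code_measurable_m])

text \<open>The first coordinate determines all digits at nonnegative positions, so the preimage of
  the line lies in cylinders at 0 of every length.\<close>

lemma vertical_line_null: "measure (mu_hat m) ({t} \<times> UNIV) = 0"
proof -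
  have B: "{t} \<times> UNIV \<in> sets (borel :: (real \<times> real) measure)"
    unfolding borel_prod[symmetric] by (rule pair_measureI) auto
  let ?A = "cf_code -` ({t} \<times> UNIV) \<inter> space m"
  have "prob ?A = 0"
  proof (rule subset_cylinders_null)
    show "?A \<in> sets m" by (rule measurable_sets[OF cf_code_measurable_m B])
    fix n
    show "\<exists>k. \<exists>u\<in>words n. ?A \<subseteq> cylinder k u"
    proof (cases "?A = {}")
      case True
      then show ?thesis by (intro exI[of _ 0] bexI[of _ "replicate n 1"]) (auto simp: words_def)
    next
      case False
      then obtain \<tau>0 where t0: "\<tau>0 \<in> space code_space" "fst (cf_code \<tau>0) = t" by (force simp: space_m)
      have "\<tau> (int i) = \<tau>0 (int i)" if "\<tau> \<in> ?A" for \<tau> i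
        by (rule cf_code_future_inj) (use that t0 in \<open>auto simp: space_m\<close>)
      then have "?A \<subseteq> cylinder 0 (map (\<lambda>i. \<tau>0 (int i)) [0..<n])"
        by (auto simp: cylinder_def space_m)
      then show ?thesis
        by (intro exI[of _ 0] bexI) (use t0 in \<open>auto simp: words_def space_code_space\<close>)
    qed
  qed
  then show ?thesis using measure_mu_hat[OF B] by simp
qed

text \<open>Here all digits at negative positions are determined; the cylinders end at position -1
  and hence start at \<open>- int n\<close>.\<close>

lemma horizontal_line_null: "measure (mu_hat m) (UNIV \<times> {t}) = 0"
proof -
  have B: "UNIV \<times> {t} \<in> sets (borel :: (real \<times> real) measure)"
    unfolding borel_prod[symmetric] by (rule pair_measureI) auto
  let ?A = "cf_code -` (UNIV \<times> {t}) \<inter> space m"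
  have "prob ?A = 0"
  proof (rule subset_cylinders_null)
    show "?A \<in> sets m" by (rule measurable_sets[OF cf_code_measurable_m B])
    fix n
    show "\<exists>k. \<exists>u\<in>words n. ?A \<subseteq> cylinder k u"
    proof (cases "?A = {}")
      case True
      then show ?thesis by (intro exI[of _ 0] bexI[of _ "replicate n 1"]) (auto simp: words_def)
    next
      case False
      then obtain \<tau>0 where t0: "\<tau>0 \<in> space code_space" "snd (cf_code \<tau>0) = t" by (force simp: space_m)
      have eq: "\<tau> (- 1 - int i) = \<tau>0 (- 1 - int i)" if "\<tau> \<in> ?A" for \<tau> i
        by (rule cf_code_past_inj) (use that t0 in \<open>auto simp: space_m\<close>)
      have "\<tau> (- int n + int j) = \<tau>0 (- int n + int j)" if "\<tau> \<in> ?A" "j < n" for \<tau> j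
      proof -
        have "- int n + int j = - 1 - int (n - 1 - j)" using that(2) by (simp add: of_nat_diff)
        then show ?thesis using eq[OF that(1)] by metis
      qed
      then have "?A \<subseteq> cylinder (- int n) (map (\<lambda>j. \<tau>0 (- int n + int j)) [0..<n])"
        by (auto simp: cylinder_def space_m)
      then show ?thesis
        by (intro exI[of _ "- int n"] bexI) (use t0 in \<open>auto simp: words_def space_code_space\<close>)
    qed
  qed
  then show ?thesis using measure_mu_hat[OF B] by simp
qed

lemma orbit_frequency:
  assumes A: "A \<in> sets borel"
  shows "AE \<tau> in m. frequency A (\<lambda>k. cf_code ((left_shift ^^ k) \<tau>)) \<longlonglongrightarrow> measure (mu_hat m) A"
proof -
  let ?B = "cf_code -` A \<inter> space m"
  have B: "?B \<in> sets m" by (rule measurable_sets[OF cf_code_measurable_m A])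
  have "AE \<tau> in m. (\<lambda>n. (\<Sum>k<n. indicator ?B ((left_shift ^^ k) \<tau>)) / real n) \<longlonglongrightarrow> (\<integral>\<tau>. indicator ?B \<tau> \<partial>m)"
  proof (rule birkhoff_ergodic[where B=1, OF prob_space_axioms shift_measurable_m shift_distr_m ergodic])
    show "indicator ?B \<in> borel_measurable m" using B by simp
    show "\<bar>indicator ?B \<tau> :: real\<bar> \<le> 1" for \<tau> by (simp add: indicator_def)
  qed
  then show ?thesis using AE_space
  proof eventually_elim
    case (elim \<tau>)
    have "(left_shift ^^ k) \<tau> \<in> space m" for k
      by (rule measurable_space[OF shift_funpow_measurable elim(2)])
    then have "frequency A (\<lambda>k. cf_code ((left_shift ^^ k) \<tau>)) = (\<lambda>n. (\<Sum>k<n. indicator ?B ((left_shift ^^ k) \<tau>)) / real n)"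
      by (simp add: frequency_def fun_eq_iff indicator_def)
    then show ?case using elim(1) measure_mu_hat[OF A] B by simp
  qed
qed

text \<open>The first coordinates agree exactly. In the second, the orbit reads the positions
  \<open>k - 1\<close>, \<open>k - 2\<close> and so on without end, whereas \<open>cf_V k\<close>
  stops at position 0 after \<open>k\<close> digits.\<close>

lemma orbit_equidistributed:
  "AE \<tau> in m. \<forall>a b c d. frequency (rect a b c d)
     (\<lambda>k. (cf_T k (fst (cf_code \<tau>)), cf_V k (fst (cf_code \<tau>)))) \<longlonglongrightarrow> measure (mu_hat m) (rect a b c d)"
proof -
  have R: "rect a b c d \<in> sets borel" for a b c d
    unfolding borel_prod[symmetric] by simp
  have "AE \<tau> in m. \<forall>a b c d :: rat. frequency (rect (of_rat a) (of_rat b) (of_rat c) (of_rat d)) (\<lambda>k. cf_code ((left_shift ^^ k) \<tau>))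
    \<longlonglongrightarrow> measure (mu_hat m) (rect (of_rat a) (of_rat b) (of_rat c) (of_rat d))"
    unfolding AE_all_countable using orbit_frequency[OF R] by blast
  then show ?thesis using AE_space
  proof eventually_elim
    case (elim \<tau>)
    have t: "\<tau> i \<ge> 1" for i using elim(2) by (simp add: space_m space_code_space)
    define w where "w = (\<lambda>i. \<tau> (int i))"
    have w: "w i \<ge> 1" for i using t by (simp add: w_def)
    have x: "fst (cf_code \<tau>) = cf_inf w" by (simp add: cf_code_def w_def)
    let ?z = "\<lambda>k. cf_code ((left_shift ^^ k) \<tau>)"
    let ?p = "\<lambda>k. (cf_T k (cf_inf w), cf_V k (cf_inf w))"
    have d: "dist (?z k) (?p k) \<le> 2 / 2 ^ k" for k
    proof -
      define v where "v = (\<lambda>i. \<tau> (int k - 1 - int i))"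
      have v: "v i \<ge> 1" for i using t by (simp add: v_def)
      have "map (\<lambda>i. w (k - 1 - i)) [0..<k] = map v [0..<k]"
        by (auto simp: w_def v_def of_nat_diff intro!: arg_cong[where f=\<tau>])
      then have p: "?p k = (cf_inf (\<lambda>i. w (k + i)), cf_fin (map v [0..<k]))"
        unfolding cf_T_cf_inf[OF w] cf_V_cf_inf[OF w] by (rule arg_cong)
      have z: "?z k = (cf_inf (\<lambda>i. w (k + i)), cf_inf v)"
        by (simp add: cf_code_def left_shift_funpow w_def v_def algebra_simps)
      show ?thesis unfolding p z dist_Pair_Pair
        using cf_inf_diff[of v k, OF v] by (simp add: dist_real_def)
    qed
    have "(\<lambda>k. dist (?z k) (?p k)) \<longlonglongrightarrow> 0"
      by (rule tendsto_sandwich[OF _ _ tendsto_const cf_error_LIMSEQ]) (use d in auto)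
    then show ?case unfolding x
      using frequency_LIMSEQ_rect[where z="?z" and p="?p",
          OF finite_measure_mu_hat sets_mu_hat vertical_line_null horizontal_line_null elim(1)[rule_format]]
      by simp
  qed
qed

text \<open>\<open>cf_digits\<close> is a definite description, so the measurability needed to pass to the image
  measure is obtained for the digits \<open>gauss_digit\<close>, with which it agrees on the relevant set.\<close>

theorem AE_equidistributed:
  "AE x in mu m. \<forall>a b c d. frequency (rect a b c d) (\<lambda>k. (cf_T k x, cf_V k x)) \<longlonglongrightarrow> measure (mu_hat m) (rect a b c d)"
proof -
  define p where "p = (\<lambda>k x. (cf_inf (\<lambda>i. gauss_digit x (k + i)), cf_fin (map (\<lambda>i. gauss_digit x (k - 1 - i)) [0..<k])))"
  \<comment> \<open>Rational sides keep the quantifiers countable and \<open>Q\<close> measurable.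
    The first two clauses present \<open>x\<close> as the value of a positive digit sequence, so
    that \<open>cf_T\<close> and \<open>cf_V\<close> can be recovered after passing to the image
    measure.\<close>
  define Q where "Q = (\<lambda>x. (\<forall>i. gauss_digit x i \<ge> 1) \<and> cf_inf (gauss_digit x) = x \<and>
    (\<forall>a b c d :: rat. (\<lambda>n. frequency (rect (of_rat a) (of_rat b) (of_rat c) (of_rat d)) (\<lambda>k. p k x) n)
      \<longlonglongrightarrow> measure (mu_hat m) (rect (of_rat a) (of_rat b) (of_rat c) (of_rat d))))"
  have p_eq: "p k (cf_inf w) = (cf_T k (cf_inf w), cf_V k (cf_inf w))" if "\<And>i. w i \<ge> 1" for k w
    unfolding p_def gauss_digit_cf_inf[OF that] cf_T_cf_inf[OF that] cf_V_cf_inf[OF that] ..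
  have [measurable]: "rect a b c d \<in> sets borel" for a b c d
    unfolding borel_prod[symmetric] by simp
  have [measurable]: "p k \<in> borel_measurable borel" for k
    unfolding p_def by (intro borel_measurable_Pair cf_inf_measurable cf_fin_measurable) measurable
  have [measurable]: "(\<lambda>x. cf_inf (gauss_digit x)) \<in> borel_measurable borel"
    using cf_inf_measurable[of "\<lambda>i x. gauss_digit x i" borel] by simp
  have "(\<lambda>x. frequency (rect a b c d) (\<lambda>k. p k x) n) \<in> borel_measurable borel" for a b c d n
    unfolding frequency_def by measurable
  note [measurable] = pred_LIMSEQ[OF this]
  have Qm: "Measurable.pred borel Q" unfolding Q_def by measurable
  \<comment> \<open>\<open>Q\<close> concerns \<open>x\<close> alone, so the statement on sequences
    descends to \<open>mu_hat m\<close> and then to its first marginal.\<close>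
  have "AE \<tau> in m. Q (fst (cf_code \<tau>))"
    using orbit_equidistributed AE_space
  proof eventually_elim
    case (elim \<tau>)
    define w where "w = (\<lambda>i. \<tau> (int i))"
    have w: "w i \<ge> 1" for i using elim(2) by (simp add: w_def space_m space_code_space)
    have x: "fst (cf_code \<tau>) = cf_inf w" by (simp add: cf_code_def w_def)
    show ?case using elim(1) w unfolding x Q_def p_eq[OF w] gauss_digit_cf_inf[OF w] by simp
  qed
  moreover have fst_m: "(fst :: real \<times> real \<Rightarrow> real) \<in> measurable borel borel"
    using measurable_fst[of "borel :: real measure" "borel :: real measure"] unfolding borel_prod .
  moreover have "{y \<in> space borel. Q (fst y)} \<in> sets (borel :: (real \<times> real) measure)"
    using measurable_compose[OF fst_m Qm] by (simp add: pred_def)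
  ultimately have "AE y in mu_hat m. Q (fst y)"
    unfolding mu_hat_def by (simp add: AE_distr_iff[OF cf_code_measurable_m])
  then have "AE x in mu m. Q x"
    using Qm fst_m unfolding mu_def
    by (subst AE_distr_iff) (auto simp: mu_hat_def pred_def)
  then show ?thesis
  proof eventually_elim
    case (elim x)
    let ?w = "gauss_digit x"
    have w: "?w i \<ge> 1" for i using elim by (simp add: Q_def)
    have x: "cf_inf ?w = x" using elim by (simp add: Q_def)
    have "p k x = (cf_T k x, cf_V k x)" for k using p_eq[of ?w k] w x by simp
    then have "frequency (rect (of_rat a) (of_rat b) (of_rat c) (of_rat d)) (\<lambda>k. (cf_T k x, cf_V k x))
      \<longlonglongrightarrow> measure (mu_hat m) (rect (of_rat a) (of_rat b) (of_rat c) (of_rat d))" for a b c d :: rat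
      using elim by (simp add: Q_def)
    then show ?case
      \<comment> \<open>The sequence is compared with itself: only the extension from rational to
        real rectangles remains.\<close>
      by (intro allI, rule frequency_LIMSEQ_rect[where z="\<lambda>k. (cf_T k x, cf_V k x)",
          OF finite_measure_mu_hat sets_mu_hat vertical_line_null horizontal_line_null]) simp_all
  qed
qed

end

theorem theorem10p1:
  fixes s :: real and m :: "(int \<Rightarrow> nat) measure"
  assumes "s > 1 / 2"
    and "gibbs_state (gauss_potential s) m"
  shows "AE x in mu m. \<forall>a b c d. a < b \<longrightarrow> c < d \<longrightarrow>
    (\<lambda>n. real (card {k \<in> {0..<n}. (cf_T k x, cf_V k x) \<in> {a<..<b} \<times> {c<..<d}}) / real n)
      \<longlonglongrightarrow> measure (mu_hat m) ({a<..<b} \<times> {c<..<d})"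
proof -
  obtain K where "quasi_bernoulli m K"
    using gibbs_state_quasi_bernoulli[OF assms(2)] by blast
  then interpret quasi_bernoulli m K .
  show ?thesis
    using AE_equidistributed
    by eventually_elim (simp add: frequency_eq_card[abs_def] del: mem_Times_iff)
qed

end
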